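(* For every positive integer $n$, let $$d_n=\frac{1}{2^{n-1}\,\mathrm{Cat}_n}\sum_{\pi\in\mathrm{Int}(n),\ \rho\in\mathrm{NC}(n)} d_H(\pi,\rho).$$ Then $$\lim_{n\to\infty}\Bigl(d_n-\frac23 n\Bigr)=-\frac{28}{27}.$$
   Context: For a positive integer $n$, a partition $\pi$ of $\{1,\ldots,n\}$ is non-crossing if there are no two distinct blocks $V,W$ of $\pi$ and numbers $a<b<c<d$ with $a,c\in V$ and $b,d\in W$. $\mathrm{NC}(n)$ is the set of non-crossing partitions of $\{1,\ldots,n\}$, partially ordered by $\pi\le\rho$ iff every block of $\pi$ is contained in a block of $\rho$. The Hasse diagram $\mathcal{H}_n$ is the undirected graph with vertex set $\mathrm{NC}(n)$ in which $\pi_1,\pi_2$ are joined by an edge iff one of them covers the other in $(\mathrm{NC}(n),\le)$; $d_H(\pi,\rho)$ is the graph distance in $\mathcal{H}_n$. $\mathrm{Int}(n)\subseteq\mathrm{NC}(n)$ is the set of interval partitions: those in which every block has the form $\{i\in\mathbb{N}\mid p\le i\le q\}$ for some $p\le q$ in $\{1,\ldots,n\}$; $|\mathrm{Int}(n)|=2^{n-1}$. $\mathrm{Cat}_n=\frac{(2n)!}{n!(n+1)!}=|\mathrm{NC}(n)|$ is the $n$th Catalan number. *)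

theory Defs
  imports
    Complex_Main
    "HOL-Library.Disjoint_Sets"
    "Graph_Theory.Pair_Digraph"
    "Graph_Theory.Shortest_Path"
begin

definition noncrossing :: "nat set set \<Rightarrow> bool" where
  "noncrossing P \<longleftrightarrow>
     \<not> (\<exists>V\<in>P. \<exists>W\<in>P. V \<noteq> W \<and>
         (\<exists>a b c d. a < b \<and> b < c \<and> c < d \<and> a \<in> V \<and> c \<in> V \<and> b \<in> W \<and> d \<in> W))"

definition NC :: "nat \<Rightarrow> nat set set set" where
  "NC n = {P. partition_on {1..n} P \<and> noncrossing P}"

definition interval_partitions :: "nat \<Rightarrow> nat set set set" where
  "interval_partitions n =
     {P \<in> NC n. \<forall>V\<in>P. \<exists>p\<in>{1..n}. \<exists>q\<in>{1..n}. p \<le> q \<and> V = {i. p \<le> i \<and> i \<le> q}}"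

text \<open>The order on \<open>NC n\<close> is the refinement order \<^const>\<open>refines\<close>; in
  \<open>NC_covers n P Q\<close> it is \<open>Q\<close> that covers \<open>P\<close>, and the intermediate element is required to
  be non-crossing, too.\<close>

definition NC_less :: "nat \<Rightarrow> nat set set \<Rightarrow> nat set set \<Rightarrow> bool" where
  "NC_less n P Q \<longleftrightarrow> P \<in> NC n \<and> Q \<in> NC n \<and> refines {1..n} P Q \<and> P \<noteq> Q"

definition NC_covers :: "nat \<Rightarrow> nat set set \<Rightarrow> nat set set \<Rightarrow> bool" where
  "NC_covers n P Q \<longleftrightarrow> NC_less n P Q \<and> \<not> (\<exists>R. NC_less n P R \<and> NC_less n R Q)"

text \<open>As usual in \<open>Graph_Theory\<close>, an undirected graph is a symmetric digraph.\<close>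

definition hasse_graph :: "nat \<Rightarrow> nat set set pair_pre_digraph" where
  "hasse_graph n =
     \<lparr> pverts = NC n,
       parcs = {(P, Q). P \<in> NC n \<and> Q \<in> NC n \<and> (NC_covers n P Q \<or> NC_covers n Q P)} \<rparr>"

lemma finite_NC: "finite (NC n)"
proof (rule finite_subset)
  show "NC n \<subseteq> Pow (Pow {1..n})"
    by (auto simp: NC_def partition_on_def)
qed simp

lemma graph_hasse_graph: "graph (with_proj (hasse_graph n))"
proof
  show "finite (arcs (with_proj (hasse_graph n)))"
    by (rule finite_subset[of _ "NC n \<times> NC n"]) (auto simp: hasse_graph_def finite_NC)
  show "symmetric (with_proj (hasse_graph n))"
    by (auto simp: symmetric_def sym_def hasse_graph_def)
qed (auto simp: hasse_graph_def finite_NC NC_covers_def NC_less_def arc_to_ends_def)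

text \<open>The graph distance is the least cost of a walk with unit weights. The value of
  \<^const>\<open>wf_digraph.\<mu>\<close> is an extended real, infinite if there is no walk; this never happens
  for two vertices of the Hasse diagram (lemma \<open>hasse_reachable\<close> below), so that nothing is
  lost in passing to a real number.\<close>

definition hasse_dist :: "nat \<Rightarrow> nat set set \<Rightarrow> nat set set \<Rightarrow> real" where
  "hasse_dist n P Q =
     real_of_ereal (wf_digraph.\<mu> (with_proj (hasse_graph n)) (\<lambda>_. 1) P Q)"

definition catalan :: "nat \<Rightarrow> real" where
  "catalan n = fact (2 * n) / (fact n * fact (n + 1))"

definition mean_dist :: "nat \<Rightarrow> real" where
  "mean_dist n =
     1 / (2 ^ (n - 1) * catalan n) *
       (\<Sum>P\<in>interval_partitions n. \<Sum>Q\<in>NC n. hasse_dist n P Q)"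

lemma NC_less_trans: "NC_less n P Q \<Longrightarrow> NC_less n Q R \<Longrightarrow> NC_less n P R"
  unfolding NC_less_def by (meson refines_asym refines_trans)

lemma singletons_in_NC: "(\<lambda>i. {i}) ` {1..n} \<in> NC n"
  unfolding NC_def partition_on_def noncrossing_def by (auto simp: disjoint_def)

lemma singletons_less:
  assumes "P \<in> NC n" "P \<noteq> (\<lambda>i. {i}) ` {1..n}"
  shows "NC_less n ((\<lambda>i. {i}) ` {1..n}) P"
  using assms singletons_in_NC[of n] unfolding NC_less_def NC_def refines_def
  by (auto simp: partition_on_def)

lemma ex_covered:
  assumes "NC_less n P Q"
  shows "\<exists>R. NC_covers n R Q"
proof -
  let ?f = "\<lambda>R. card {S. NC_less n S R}"
  let ?A = "{R. NC_less n R Q}"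
  have fin: "finite {S. NC_less n S R}" for R
    by (rule finite_subset[OF _ finite_NC[of n]]) (auto simp: NC_less_def)
  obtain R where R: "R \<in> ?A" and max: "\<And>S. S \<in> ?A \<Longrightarrow> ?f S \<le> ?f R"
  proof -
    have fin_im: "finite (?f ` ?A)" and "?f ` ?A \<noteq> {}" using fin[of Q] assms by auto
    then have "Max (?f ` ?A) \<in> ?f ` ?A" by (rule Max_in)
    then obtain R where "R \<in> ?A" and R: "Max (?f ` ?A) = ?f R" by (rule imageE)
    moreover have "?f S \<le> ?f R" if "S \<in> ?A" for S
      using Max_ge[OF fin_im imageI[OF that]] unfolding R .
    ultimately show ?thesis using that by blast
  qed
  have "\<not> NC_less n R S" if "NC_less n S Q" for S
  proof
    assume RS: "NC_less n R S"
    have "{T. NC_less n T R} \<subset> {T. NC_less n T S}"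
      using RS NC_less_trans[OF _ RS] by (auto simp: NC_less_def)
    then have "?f R < ?f S" using fin by (intro psubset_card_mono)
    then show False using max[of S] that by simp
  qed
  then show ?thesis using R by (auto simp: NC_covers_def)
qed

lemma hasse_reachable:
  assumes "P \<in> NC n" "Q \<in> NC n"
  shows "P \<rightarrow>\<^sup>*\<^bsub>with_proj (hasse_graph n)\<^esub> Q"
proof -
  interpret graph "with_proj (hasse_graph n)" by (rule graph_hasse_graph)
  have adj: "R \<rightarrow>\<^bsub>with_proj (hasse_graph n)\<^esub> S" if "NC_covers n R S \<or> NC_covers n S R" for R S
    using that by (auto simp: hasse_graph_def NC_covers_def NC_less_def)
  let ?B = "(\<lambda>i. {i}) ` {1..n}"
  have fin: "finite {S. NC_less n S R}" for R
    by (rule finite_subset[OF _ finite_NC[of n]]) (auto simp: NC_less_def)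
  have bot: "R \<rightarrow>\<^sup>*\<^bsub>with_proj (hasse_graph n)\<^esub> ?B" if "R \<in> NC n" for R
    using that
  proof (induction "card {S. NC_less n S R}" arbitrary: R rule: less_induct)
    case less
    show ?case
    proof (cases "R = ?B")
      case True
      have "R \<in> verts (with_proj (hasse_graph n))"
        using less.prems by (simp add: hasse_graph_def)
      then show ?thesis using True reachable_refl by metis
    next
      case False
      obtain S where S: "NC_covers n S R"
        using ex_covered singletons_less[OF less.prems False] by blast
      then have SR: "NC_less n S R" by (simp add: NC_covers_def)
      have "{T. NC_less n T S} \<subset> {T. NC_less n T R}"
        using SR NC_less_trans[OF _ SR] by (auto simp: NC_less_def)
      then have "card {T. NC_less n T S} < card {T. NC_less n T R}"
        using fin by (intro psubset_card_mono)
      then have "S \<rightarrow>\<^sup>*\<^bsub>with_proj (hasse_graph n)\<^esub> ?B"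
        using less.hyps SR by (simp add: NC_less_def)
      then show ?thesis
        using adj[of R S] S adj_reachable_trans by blast
    qed
  qed
  have "?B \<rightarrow>\<^sup>*\<^bsub>with_proj (hasse_graph n)\<^esub> Q"
    using bot[OF assms(2)] symmetric_reachable[OF sym_arcs] by blast
  then show ?thesis using bot[OF assms(1)] reachable_trans by blast
qed

lemma hasse_dist_eq_shortest_walk:
  assumes "P \<in> NC n" "Q \<in> NC n"
  shows "hasse_dist n P Q =
    real (LEAST k. \<exists>p. pre_digraph.awalk (with_proj (hasse_graph n)) P p Q \<and> length p = k)"
proof -
  interpret graph "with_proj (hasse_graph n)" by (rule graph_hasse_graph)
  let ?W = "\<lambda>k. \<exists>p. awalk P p Q \<and> length p = k"
  have cost: "awalk_cost (\<lambda>_. 1) p = real (length p)" for p :: "(nat set set \<times> nat set set) awalk"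
    by (simp add: awalk_cost_def sum_list_triv)
  have "\<exists>k. ?W k" using hasse_reachable[OF assms] by (simp add: reachable_awalk)
  then have L: "?W (Least ?W)" by (rule LeastI_ex)
  have "\<mu> (\<lambda>_. 1) P Q = ereal (real (Least ?W))"
    unfolding \<mu>_def cost
  proof (rule antisym)
    show "(INF p\<in>{p. awalk P p Q}. ereal (real (length p))) \<le> ereal (real (Least ?W))"
      using L by (metis (mono_tags, lifting) INF_lower mem_Collect_eq)
    show "ereal (real (Least ?W)) \<le> (INF p\<in>{p. awalk P p Q}. ereal (real (length p)))"
    proof (rule INF_greatest)
      fix p assume "p \<in> {p. awalk P p Q}"
      then have "Least ?W \<le> length p" by (intro Least_le) auto
      then show "ereal (real (Least ?W)) \<le> ereal (real (length p))" by simp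
    qed
  qed
  then show ?thesis by (simp add: hasse_dist_def)
qed

end

(*
The join of an interval partition pi and a non-crossing partition rho is again non-crossing, and
then d_H(pi, rho) = |pi| + |rho| - 2 |pi v rho|: going up from pi and down to rho through the join
takes that many steps, and rho -> |pi| + |rho| - 2 |pi v rho| changes by at most 1 along an edge.
Decomposing rho at the second element of the block of 1 gives, for the generating functions
G of all pairs, S of the pairs with 1 and n in the same block of the join, and W of the distances,
a linear system over G = 1 + 2 x G^2 whose solution satisfies
  (1 + x) S = 2 x (2 G - 1)   and   3 W = 2 x G' - 4 (G - 1) + 2 S.
Hence d_n = (2 n - 4) / 3 + (2 / 3) p_n, where p_n = S_n / G_n is the probability that 1 and n lie
in the same block of the join. The first identity says S_(n+1) + S_n = 4 G_n, and as
G_(n+1) / G_n -> 8, this forces p_n -> 4 / 9.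
*)

theory Submission
  imports Defs "HOL-Computational_Algebra.Formal_Power_Series"
begin

section \<open>Connectivity\<close>

text \<open>Partitions are handled through generating relations: the join is generated by a union,
  and being non-crossing depends only on the generated equivalence. Adding a pair of consecutive
  numbers never creates a crossing, since no number lies strictly between them. An interval
  partition is generated by such pairs, so its join with \<rho> stays non-crossing. For two
  arbitrary non-crossing partitions this fails: joining 1 to 3 in one and 2 to 4 in the other gives
  a crossing.

  The series S is forced by cycles. Let m be the second element of the block of 1, if there is one.
  The part between 1 and m and the part from m on are linked to 1 and to each other by at most three
  edges: {1,m} from \<rho>, and {1,2} and {m-1,m} from \<pi>. Each of them lowers the number of
  blocks of the join by one unless it closes a cycle. If 2 < m, the only possible cycle runs through
  1, 2, m-1 and m; it closes iff all three edges are present and 2 and m-1 already lie in one block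
  of the join formed inside {2,...,m-1}. So this is the only statistic of a subtree, beside
  emptiness and its root flag, that the recursion for the distance has to carry.\<close>

definition conn :: "'a rel \<Rightarrow> 'a rel" where
  "conn E = (E \<union> E\<inverse>)\<^sup>*"

lemma conn_refl [simp]: "(x, x) \<in> conn E"
  by (simp add: conn_def)

lemma conn_edge: "(x, y) \<in> E \<Longrightarrow> (x, y) \<in> conn E"
  by (auto simp: conn_def)

lemma conn_trans: "(x, y) \<in> conn E \<Longrightarrow> (y, z) \<in> conn E \<Longrightarrow> (x, z) \<in> conn E"
  unfolding conn_def by (rule rtrancl_trans)

lemma conn_sym: "(x, y) \<in> conn E \<Longrightarrow> (y, x) \<in> conn E"
  unfolding conn_def by (meson sym_Un_converse sym_rtrancl symD)

lemma conn_sym_iff: "(x, y) \<in> conn E \<longleftrightarrow> (y, x) \<in> conn E"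
  using conn_sym by metis

text \<open>The main tool for showing that points are not connected. With \<open>F = {}\<close> and
  a predicate as \<open>h\<close> it is an invariant argument, because \<open>conn {} = Id\<close>.
  With a retraction \<open>h\<close> onto a part of the graph it shows that paths outside this part
  create no connection inside.\<close>

lemma conn_hom:
  assumes "(x, y) \<in> conn E" and hom: "\<And>u v. (u, v) \<in> E \<Longrightarrow> (h u, h v) \<in> conn F"
  shows "(h x, h y) \<in> conn F"
  using assms(1) unfolding conn_def[of E]
proof (induction rule: rtrancl_induct)
  case (step y z)
  have "(y, z) \<in> E \<or> (z, y) \<in> E" using step.hyps(2) by simp
  then have "(h y, h z) \<in> conn F" using hom conn_sym by metis
  then show ?case using step.IH conn_trans by metis
qed simp

lemma conn_least: "E \<subseteq> conn F \<Longrightarrow> conn E \<subseteq> conn F"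
proof
  fix p assume E: "E \<subseteq> conn F" and p: "p \<in> conn E"
  obtain x y where [simp]: "p = (x, y)" by (cases p)
  show "p \<in> conn F"
    using conn_hom[of x y E id F] p E unfolding id_def \<open>p = (x, y)\<close> by blast
qed

lemma conn_mono: "E \<subseteq> F \<Longrightarrow> conn E \<subseteq> conn F"
  by (rule conn_least) (auto intro: conn_edge)

lemma conn_Un_cong: "conn E = conn E' \<Longrightarrow> conn F = conn F' \<Longrightarrow> conn (E \<union> F) = conn (E' \<union> F')"
proof -
  have E: "E \<subseteq> conn E" for E :: "'a rel" using conn_edge by fast
  have *: "conn (E \<union> F) \<subseteq> conn (E' \<union> F')" if "conn E = conn E'" "conn F = conn F'" for E E' F F' :: "'a rel"
  proof (rule conn_least, rule Un_least)
    show "E \<subseteq> conn (E' \<union> F')" using E[of E] conn_mono[of E' "E' \<union> F'"] that by blast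
    show "F \<subseteq> conn (E' \<union> F')" using E[of F] conn_mono[of F' "E' \<union> F'"] that by blast
  qed
  assume "conn E = conn E'" "conn F = conn F'"
  then show ?thesis by (intro equalityI *) auto
qed

lemma conn_field: "(x, y) \<in> conn E \<Longrightarrow> E \<subseteq> V \<times> V \<Longrightarrow> x = y \<or> x \<in> V \<and> y \<in> V"
  unfolding conn_def by (induction rule: rtrancl_induct) auto

lemma conn_empty [simp]: "conn {} = Id"
  by (simp add: conn_def)

text \<open>A path needs the new edge at most once, in one of its two directions.\<close>

lemma conn_insert_iff:
  "(x, y) \<in> conn (insert (a, b) E) \<longleftrightarrow> (x, y) \<in> conn E \<or>
     (x, a) \<in> conn E \<and> (b, y) \<in> conn E \<or> (x, b) \<in> conn E \<and> (a, y) \<in> conn E"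
proof
  assume "(x, y) \<in> conn (insert (a, b) E)"
  then show "(x, y) \<in> conn E \<or>
     (x, a) \<in> conn E \<and> (b, y) \<in> conn E \<or> (x, b) \<in> conn E \<and> (a, y) \<in> conn E"
    unfolding conn_def[of "insert (a, b) E"]
  proof (induction rule: rtrancl_induct)
    case (step y z)
    then have "(y, z) \<in> conn E \<or> (y = a \<and> z = b) \<or> (y = b \<and> z = a)"
      using conn_edge conn_sym by fast
    then show ?case using step.IH by (metis conn_refl conn_trans conn_sym)
  qed simp
next
  have E: "(u, v) \<in> conn (insert (a, b) E)" if "(u, v) \<in> conn E" for u v
    using that conn_mono[of E "insert (a, b) E"] by blast
  have "(a, b) \<in> conn (insert (a, b) E)" by (simp add: conn_edge)
  moreover assume "(x, y) \<in> conn E \<or>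
     (x, a) \<in> conn E \<and> (b, y) \<in> conn E \<or> (x, b) \<in> conn E \<and> (a, y) \<in> conn E"
  ultimately show "(x, y) \<in> conn (insert (a, b) E)"
    using E by (meson conn_sym conn_trans)
qed

lemma equiv_conn: "equiv UNIV (conn E)"
  by (intro equivI) (auto simp: refl_on_def sym_def trans_def intro: conn_sym conn_trans)

lemma conn_Image_eq_iff: "conn E `` {x} = conn E `` {y} \<longleftrightarrow> (x, y) \<in> conn E"
  using eq_equiv_class_iff[OF equiv_conn, of x y E] by simp

section \<open>Components and how an additional edge changes their number\<close>

definition comps :: "'a set \<Rightarrow> 'a rel \<Rightarrow> 'a set set" where
  "comps V E = (\<lambda>x. conn E `` {x}) ` V"

lemma finite_comps [simp]: "finite V \<Longrightarrow> finite (comps V E)"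
  by (simp add: comps_def)

lemma comps_cong: "conn E = conn F \<Longrightarrow> comps V E = comps V F"
  by (simp add: comps_def)

text \<open>Only the classes of \<open>a\<close> and \<open>b\<close> are affected: they merge,
  while \<open>?K\<close> collects the untouched ones.\<close>

lemma card_comps_insert:
  assumes "finite V" "a \<in> V" "b \<in> V"
  shows "card (comps V E) = card (comps V (insert (a, b) E)) + (if (a, b) \<in> conn E then 0 else 1)"
proof (cases "(a, b) \<in> conn E")
  case True
  then have "conn (insert (a, b) E) = conn E"
    by (intro equalityI conn_least conn_mono) (auto intro: conn_edge)
  then show ?thesis using True comps_cong[of "insert (a, b) E" E V] by simp
next
  case False
  let ?A = "conn E `` {a}" and ?B = "conn E `` {b}" and ?F = "insert (a, b) E"
  let ?K = "(\<lambda>x. conn E `` {x}) ` {x \<in> V. (x, a) \<notin> conn E \<and> (x, b) \<notin> conn E}"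
  have cls: "conn ?F `` {x} = (if (x, a) \<in> conn E \<or> (x, b) \<in> conn E then ?A \<union> ?B else conn E `` {x})" for x
    by (auto simp: conn_insert_iff) (meson conn_trans conn_sym)+
  have "comps V E = insert ?A (insert ?B ?K)"
  proof
    show "comps V E \<subseteq> insert ?A (insert ?B ?K)"
    proof
      fix X assume "X \<in> comps V E"
      then obtain x where x: "x \<in> V" "X = conn E `` {x}" by (auto simp: comps_def)
      then show "X \<in> insert ?A (insert ?B ?K)"
        using conn_Image_eq_iff[of E x a] conn_Image_eq_iff[of E x b] by blast
    qed
    show "insert ?A (insert ?B ?K) \<subseteq> comps V E"
      using assms by (auto simp: comps_def)
  qed
  moreover have "?A \<noteq> ?B" using False by (simp add: conn_Image_eq_iff)
  moreover have "?A \<notin> ?K" "?B \<notin> ?K"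
    using conn_Image_eq_iff[of E _ a] conn_Image_eq_iff[of E _ b] by blast+
  moreover have "finite ?K" using assms by simp
  ultimately have "card (comps V E) = card ?K + 2" by simp
  have eq: "comps V ?F = insert (?A \<union> ?B) ?K"
  proof
    show "comps V ?F \<subseteq> insert (?A \<union> ?B) ?K"
    proof
      fix X assume "X \<in> comps V ?F"
      then obtain x where "x \<in> V" "X = conn ?F `` {x}" by (auto simp: comps_def)
      then show "X \<in> insert (?A \<union> ?B) ?K" unfolding cls by auto
    qed
    have "conn E `` {x} \<in> comps V ?F" if "x \<in> V" "(x, a) \<notin> conn E" "(x, b) \<notin> conn E" for x
      using that cls[of x] unfolding comps_def by (intro image_eqI[of _ _ x]) auto
    moreover have "?A \<union> ?B \<in> comps V ?F"
      using assms cls[of a] unfolding comps_def by (intro image_eqI[of _ _ a]) auto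
    ultimately show "insert (?A \<union> ?B) ?K \<subseteq> comps V ?F" by auto
  qed
  have "?A \<union> ?B \<notin> ?K"
  proof
    assume "?A \<union> ?B \<in> ?K"
    then obtain x where x: "(x, a) \<notin> conn E" "?A \<union> ?B = conn E `` {x}" by auto
    have "a \<in> ?A \<union> ?B" by simp
    then show False using x unfolding x(2) by blast
  qed
  then have "card (comps V ?F) = card ?K + 1" using \<open>finite ?K\<close> by (simp add: eq)
  then show ?thesis using False \<open>card (comps V E) = card ?K + 2\<close> by simp
qed

lemma conn_Un_disjoint:
  assumes "E \<subseteq> V \<times> V" "F \<subseteq> W \<times> W" "V \<inter> W = {}" "x \<in> V"
  shows "(x, y) \<in> conn (E \<union> F) \<longleftrightarrow> (x, y) \<in> conn E"
proof
  assume xy: "(x, y) \<in> conn (E \<union> F)"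
  have "(x \<in> V, y \<in> V) \<in> conn {}"
    using xy by (rule conn_hom) (use assms in auto)
  then have "y \<in> V" using assms by simp
  \<comment> \<open>Collapsing everything outside \<open>V\<close> to \<open>x\<close> turns the
    edges of \<open>F\<close> into loops.\<close>
  have "((if x \<in> V then x else x), (if y \<in> V then y else x)) \<in> conn E"
    using xy by (rule conn_hom[where h = "\<lambda>z. if z \<in> V then z else x"])
      (use assms in \<open>auto intro: conn_edge\<close>)
  then show "(x, y) \<in> conn E" using \<open>y \<in> V\<close> by simp
next
  assume "(x, y) \<in> conn E"
  then show "(x, y) \<in> conn (E \<union> F)" using conn_mono[of E "E \<union> F"] by blast
qed

lemma card_comps_Un:
  assumes "E \<subseteq> V \<times> V" "F \<subseteq> W \<times> W" "V \<inter> W = {}" "finite V" "finite W"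
  shows "card (comps (V \<union> W) (E \<union> F)) = card (comps V E) + card (comps W F)"
proof -
  have V: "conn (E \<union> F) `` {x} = conn E `` {x}" if "x \<in> V" for x
    using conn_Un_disjoint[OF assms(1-3) that] by auto
  have W: "conn (E \<union> F) `` {x} = conn F `` {x}" if "x \<in> W" for x
    using conn_Un_disjoint[OF assms(2,1) _ that, of] assms(3) by (auto simp: Un_commute Int_commute)
  have "comps (V \<union> W) (E \<union> F) = comps V E \<union> comps W F"
    by (simp add: comps_def image_Un V W)
  moreover have "comps V E \<inter> comps W F = {}"
  proof -
    have "X \<subseteq> V \<and> X \<noteq> {}" if "X \<in> comps V E" for X
    proof -
      obtain x where x: "x \<in> V" "X = conn E `` {x}" using \<open>X \<in> comps V E\<close> by (auto simp: comps_def)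
      then have "x \<in> X" by simp
      moreover have "X \<subseteq> V" using x conn_field[OF _ assms(1), of x] by auto
      ultimately show ?thesis by blast
    qed
    moreover have "X \<subseteq> W" if "X \<in> comps W F" for X
    proof -
      obtain x where x: "x \<in> W" "X = conn F `` {x}" using \<open>X \<in> comps W F\<close> by (auto simp: comps_def)
      then show ?thesis using conn_field[OF _ assms(2), of x] by auto
    qed
    ultimately show ?thesis using assms(3) by blast
  qed
  ultimately show ?thesis using assms by (simp add: card_Un_disjoint)
qed

section \<open>Partitions as relations\<close>

definition same_block :: "'a set set \<Rightarrow> 'a rel" where
  "same_block P = (\<Union>X\<in>P. X \<times> X)"

lemma same_block_iff: "(x, y) \<in> same_block P \<longleftrightarrow> (\<exists>X\<in>P. x \<in> X \<and> y \<in> X)"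
  by (auto simp: same_block_def)

lemma same_block_subset: "partition_on V P \<Longrightarrow> same_block P \<subseteq> V \<times> V"
  by (auto simp: same_block_def partition_on_def)

lemma same_block_trans:
  "partition_on V P \<Longrightarrow> (x, y) \<in> same_block P \<Longrightarrow> (y, z) \<in> same_block P \<Longrightarrow> (x, z) \<in> same_block P"
  unfolding same_block_iff partition_on_def disjoint_def by blast

text \<open>The summand \<open>Id\<close> is there because \<open>conn\<close> is reflexive on the
  whole type, also outside the ground set, where \<open>same_block P\<close> is empty.\<close>

lemma conn_same_block:
  assumes "partition_on V P"
  shows "conn (same_block P) = Id \<union> same_block P"
proof
  show "Id \<union> same_block P \<subseteq> conn (same_block P)" by (auto intro: conn_edge)
  have "(x, y) \<in> (same_block P \<union> (same_block P)\<inverse>)\<^sup>* \<Longrightarrow> (x, y) \<in> Id \<union> same_block P" for x y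
  proof (induction rule: rtrancl_induct)
    case (step y z)
    then have "(y, z) \<in> same_block P" by (auto simp: same_block_iff)
    then show ?case using step.IH same_block_trans[OF assms] by auto
  qed simp
  then show "conn (same_block P) \<subseteq> Id \<union> same_block P" by (auto simp: conn_def)
qed

lemma comps_same_block:
  assumes "partition_on V P"
  shows "comps V (same_block P) = P"
proof -
  have cls: "conn (same_block P) `` {x} = X" if "X \<in> P" "x \<in> X" for x X
  proof -
    have "Y = X" if "Y \<in> P" "x \<in> Y" for Y
      using that \<open>X \<in> P\<close> \<open>x \<in> X\<close> assms unfolding partition_on_def disjoint_def by blast
    then have "(x, y) \<in> same_block P \<longleftrightarrow> y \<in> X" for y
      using that by (metis same_block_iff)
    then show ?thesis
      using that unfolding conn_same_block[OF assms] by blast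
  qed
  have V: "V = \<Union>P" and ne: "{} \<notin> P" using assms by (auto simp: partition_on_def)
  show ?thesis
  proof
    show "comps V (same_block P) \<subseteq> P"
      unfolding comps_def V using cls by auto
    show "P \<subseteq> comps V (same_block P)"
    proof
      fix X assume X: "X \<in> P"
      then obtain x where "x \<in> X" using ne by (metis all_not_in_conv)
      then show "X \<in> comps V (same_block P)"
        unfolding comps_def V using cls[OF X] X by (intro image_eqI[of _ _ x]) auto
    qed
  qed
qed

lemma same_block_comps_conn:
  assumes "E \<subseteq> V \<times> V"
  shows "Id \<union> same_block (comps V E) = conn E"
proof -
  have "(x, y) \<in> conn E \<longleftrightarrow> x = y \<or> (\<exists>z\<in>V. (z, x) \<in> conn E \<and> (z, y) \<in> conn E)" for x y
  proof
    assume xy: "(x, y) \<in> conn E"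
    show "x = y \<or> (\<exists>z\<in>V. (z, x) \<in> conn E \<and> (z, y) \<in> conn E)"
      using conn_field[OF xy assms] xy conn_refl by metis
  next
    assume "x = y \<or> (\<exists>z\<in>V. (z, x) \<in> conn E \<and> (z, y) \<in> conn E)"
    then show "(x, y) \<in> conn E"
      using conn_trans[of x _ E y] conn_sym[of _ x E] conn_refl[of x E] by blast
  qed
  moreover have "(x, y) \<in> Id \<union> same_block (comps V E) \<longleftrightarrow>
      x = y \<or> (\<exists>z\<in>V. (z, x) \<in> conn E \<and> (z, y) \<in> conn E)" for x y
    by (simp add: same_block_iff comps_def)
  ultimately have "(x, y) \<in> Id \<union> same_block (comps V E) \<longleftrightarrow> (x, y) \<in> conn E" for x y
    by blast
  then show ?thesis by (intro set_eqI) (simp only: split_paired_all)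
qed

lemma partition_on_comps:
  assumes "E \<subseteq> V \<times> V"
  shows "partition_on V (comps V E)"
proof (rule partition_onI)
  show "\<Union> (comps V E) = V"
  proof
    show "\<Union> (comps V E) \<subseteq> V"
    proof
      fix y assume "y \<in> \<Union> (comps V E)"
      then obtain x where "x \<in> V" "(x, y) \<in> conn E" by (auto simp: comps_def)
      then show "y \<in> V" using conn_field[OF _ assms, of x y] by auto
    qed
    show "V \<subseteq> \<Union> (comps V E)" by (auto simp: comps_def)
  qed
  show "disjnt p q" if "p \<in> comps V E" "q \<in> comps V E" "p \<noteq> q" for p q
  proof -
    obtain x y where [simp]: "p = conn E `` {x}" "q = conn E `` {y}"
      using \<open>p \<in> _\<close> \<open>q \<in> _\<close> unfolding comps_def by blast
    have "(x, y) \<notin> conn E" using \<open>p \<noteq> q\<close> by (simp add: conn_Image_eq_iff)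
    then have "\<not> ((x, z) \<in> conn E \<and> (y, z) \<in> conn E)" for z
      using conn_trans conn_sym by metis
    then show ?thesis by (auto simp: disjnt_def)
  qed
  have "x \<in> conn E `` {x}" for x by simp
  then show "{} \<notin> comps V E" unfolding comps_def by blast
qed

lemma conn_same_block_comps: "E \<subseteq> V \<times> V \<Longrightarrow> conn (same_block (comps V E)) = conn E"
  by (metis conn_same_block partition_on_comps same_block_comps_conn)

section \<open>The Hasse diagram of the non-crossing partitions\<close>

text \<open>Phrased for the generated equivalence, so that any generating relation can stand for its
  partition and blocks need not be mentioned.\<close>

definition nonx :: "nat rel \<Rightarrow> bool" where
  "nonx E \<longleftrightarrow> (\<forall>a b c d. a < b \<and> b < c \<and> c < d \<and> (a, c) \<in> conn E \<and> (b, d) \<in> conn E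
     \<longrightarrow> (a, b) \<in> conn E)"

lemma nonxD:
  "nonx E \<Longrightarrow> a < b \<Longrightarrow> b < c \<Longrightarrow> c < d \<Longrightarrow> (a, c) \<in> conn E \<Longrightarrow> (b, d) \<in> conn E \<Longrightarrow> (a, b) \<in> conn E"
  unfolding nonx_def by blast

lemma nonx_cong: "conn E = conn F \<Longrightarrow> nonx E = nonx F"
  by (simp add: nonx_def)

lemma noncrossing_iff_nonx:
  assumes "partition_on V P"
  shows "noncrossing P \<longleftrightarrow> nonx (same_block P)"
proof
  assume nc: "noncrossing P"
  show "nonx (same_block P)"
    unfolding nonx_def conn_same_block[OF assms]
  proof (intro allI impI)
    fix a b c d :: nat
    assume H: "a < b \<and> b < c \<and> c < d \<and> (a, c) \<in> Id \<union> same_block P \<and> (b, d) \<in> Id \<union> same_block P"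
    then have "(a, c) \<in> same_block P" "(b, d) \<in> same_block P" by auto
    then obtain X Y where XY: "X \<in> P" "a \<in> X" "c \<in> X" "Y \<in> P" "b \<in> Y" "d \<in> Y"
      unfolding same_block_iff by blast
    have "X = Y"
    proof (rule ccontr)
      assume "X \<noteq> Y"
      moreover have "a < b" "b < c" "c < d" using H by auto
      ultimately show False using nc XY unfolding noncrossing_def by metis
    qed
    with XY show "(a, b) \<in> Id \<union> same_block P" unfolding same_block_def by blast
  qed
next
  assume nx: "nonx (same_block P)"
  show "noncrossing P"
    unfolding noncrossing_def
  proof clarify
    fix V W a b c d
    assume *: "V \<in> P" "W \<in> P" "V \<noteq> W" "a < b" "b < c" "c < d" "a \<in> V" "c \<in> V" "b \<in> W" "d \<in> W"
    then have "(a, c) \<in> conn (same_block P)" "(b, d) \<in> conn (same_block P)"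
      by (auto simp: same_block_iff intro!: conn_edge)
    then have "(a, b) \<in> conn (same_block P)" using nx * unfolding nonx_def by blast
    then obtain U where "U \<in> P" "a \<in> U" "b \<in> U"
      using \<open>a < b\<close> unfolding conn_same_block[OF assms] by (auto simp: same_block_iff)
    moreover from this have "U = V" "U = W"
      using * assms unfolding partition_on_def disjoint_def by (metis IntI empty_iff)+
    ultimately show False using \<open>V \<noteq> W\<close> by simp
  qed
qed

lemma comps_in_NC:
  assumes "E \<subseteq> {1..n} \<times> {1..n}" "nonx E"
  shows "comps {1..n} E \<in> NC n"
  using assms partition_on_comps[OF assms(1)] noncrossing_iff_nonx
    nonx_cong[OF conn_same_block_comps[OF assms(1)]]
  by (auto simp: NC_def)

lemma NC_D:
  assumes "P \<in> NC n"
  shows "partition_on {1..n} P" "nonx (same_block P)" "same_block P \<subseteq> {1..n} \<times> {1..n}"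
    "comps {1..n} (same_block P) = P"
proof -
  show part: "partition_on {1..n} P" using assms by (simp add: NC_def)
  show "nonx (same_block P)" using assms noncrossing_iff_nonx[OF part] by (simp add: NC_def)
  show "same_block P \<subseteq> {1..n} \<times> {1..n}" by (rule same_block_subset[OF part])
  show "comps {1..n} (same_block P) = P" by (rule comps_same_block[OF part])
qed

text \<open>In the circular order on its block of \<^term>\<open>conn F\<close>, \<^term>\<open>a\<close> and \<^term>\<open>b\<close> are
  neighbours, so that no other pair of this block separates them strictly.\<close>

lemma nonx_insert:
  assumes E: "nonx E" and F: "nonx F" "E \<subseteq> conn F"
    and ab: "a < b" "(a, b) \<in> conn F" "\<And>z. a < z \<Longrightarrow> z < b \<Longrightarrow> (a, z) \<notin> conn F"
  shows "nonx (insert (a, b) E)"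
  unfolding nonx_def
proof (intro allI impI)
  fix x1 x2 x3 x4
  let ?I = "insert (a, b) E"
  assume "x1 < x2 \<and> x2 < x3 \<and> x3 < x4 \<and> (x1, x3) \<in> conn ?I \<and> (x2, x4) \<in> conn ?I"
  then have lt: "x1 < x2" "x2 < x3" "x3 < x4" and I: "(x1, x3) \<in> conn ?I" "(x2, x4) \<in> conn ?I"
    by auto
  have IF: "conn ?I \<subseteq> conn F" using F ab by (intro conn_least) auto
  have EI: "conn E \<subseteq> conn ?I" by (intro conn_mono) auto
  have "(x1, x2) \<in> conn F" using F(1) lt I IF unfolding nonx_def by blast
  then have F4: "(x1, x3) \<in> conn F" "(x2, x4) \<in> conn F" "(x1, x2) \<in> conn F" using I IF by auto
  have out: "x \<le> a \<or> b \<le> x" if "(a, x) \<in> conn F" for x using ab(3)[of x] that by linarith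
  have EF: "conn E \<subseteq> conn F" using F(2) by (rule conn_least)
  have EE: "(p, q) \<in> conn E" if "p < q" "q < r" "r < s" "(p, r) \<in> conn E" "(q, s) \<in> conn E" for p q r s
    using E that unfolding nonx_def by blast
  show "(x1, x2) \<in> conn ?I"
  proof (rule ccontr)
    assume no: "(x1, x2) \<notin> conn ?I"
    have nI: "(p, q) \<notin> conn ?I" if "p \<in> {x1, x3}" "q \<in> {x2, x4}" for p q
    proof
      assume "(p, q) \<in> conn ?I"
      moreover have "(x1, p) \<in> conn ?I" "(q, x2) \<in> conn ?I" using that I conn_sym by auto
      ultimately show False using no conn_trans by metis
    qed
    have n: "\<not> ((p, r) \<in> conn E \<and> (q, r) \<in> conn E)" if "p \<in> {x1, x3}" "q \<in> {x2, x4}" for p q r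
      using nI[OF that] EI conn_trans[of p r E q] conn_sym[of q r E] by blast
    have nn: "\<not> ((p, r) \<in> conn E \<and> (q, r) \<in> conn E)" "(p, q) \<notin> conn E" "(q, p) \<notin> conn E"
      if "p = x1 \<or> p = x3" "q = x2 \<or> q = x4" for p q r
      using that n[of p q r] n[of p q q] conn_sym[of q p E] by auto
    have ns: "\<not> ((x1, r) \<in> conn E \<and> (x2, r) \<in> conn E)" "\<not> ((x1, r) \<in> conn E \<and> (x4, r) \<in> conn E)"
      "\<not> ((x3, r) \<in> conn E \<and> (x2, r) \<in> conn E)" "\<not> ((x3, r) \<in> conn E \<and> (x4, r) \<in> conn E)" for r
      by (rule nn(1); simp)+
    have nd: "(x1, x2) \<notin> conn E" "(x2, x3) \<notin> conn E"
      by (rule nn(2,3); simp)+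
    have "(x1, p) \<in> conn F" if "p \<in> {x1, x2, x3, x4}" for p
      using that F4 conn_trans[of x1 x2 F x4] by auto
    then have lk: "(p, q) \<in> conn F" if "p \<in> {x1, x2, x3, x4}" "q \<in> {x1, x2, x3, x4}" for p q
      using that by (meson conn_sym conn_trans)
    have sym: "(a, x) \<in> conn E \<longleftrightarrow> (x, a) \<in> conn E" "(b, x) \<in> conn E \<longleftrightarrow> (x, b) \<in> conn E" for x
      by (rule conn_sym_iff)+
    \<comment> \<open>By \<open>conn_insert_iff\<close> a pair that is connected only after the
      insertion is connected through the new edge. If both pairs needed it, \<open>x1\<close> and
      \<open>x2\<close> would be connected; so exactly one of them does, in one of two directions.
      The four cases are alike.\<close>
    have "\<not> ((x1, x3) \<in> conn E \<and> (x2, x4) \<in> conn E)"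
      using EE lt no EI by blast
    then consider "(x1, x3) \<in> conn E" "(x2, a) \<in> conn E" "(x4, b) \<in> conn E"
      | "(x1, x3) \<in> conn E" "(x2, b) \<in> conn E" "(x4, a) \<in> conn E"
      | "(x2, x4) \<in> conn E" "(x1, a) \<in> conn E" "(x3, b) \<in> conn E"
      | "(x2, x4) \<in> conn E" "(x1, b) \<in> conn E" "(x3, a) \<in> conn E"
      using I n[of x1 x2 a] n[of x1 x2 b] n[of x1 x4 a] n[of x1 x4 b]
      unfolding conn_insert_iff[of _ _ a b E] sym by blast
    then show False
    proof cases
      case 1
      \<comment> \<open>As members of the block of \<open>a\<close> in \<open>conn F\<close>,
        \<open>x1\<close> and \<open>x3\<close> do not lie between \<open>a\<close> and
        \<open>b\<close>. In each of the three positions left, \<open>(x1, x3)\<close> crosses a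
        pair formed by \<open>x2\<close> or \<open>x4\<close> with \<open>a\<close> or
        \<open>b\<close> inside \<open>E\<close>, which \<open>E\<close> does not permit.\<close>
      note c = this
      have "(a, x2) \<in> conn F" using c EF sym by (metis subsetD)
      then have "x1 \<le> a \<or> b \<le> x1" "x3 \<le> a \<or> b \<le> x3"
        using out conn_trans[OF _ lk[of x2 x1]] conn_trans[OF _ lk[of x2 x3]] by simp_all
      moreover have "a \<noteq> x1" "a \<noteq> x3" "b \<noteq> x1" "b \<noteq> x3"
        using c ns conn_refl by metis+
      ultimately consider "x1 < a" "b < x3" | "x3 < a" | "b < x1" using ab(1) lt by linarith
      then show ?thesis
      proof cases
        case 1
        then have "(x1, b) \<in> conn E" using EE[of x1 b x3 x4] lt ab(1) c sym by simp
        then show ?thesis using c sym ns nd by metis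
      next
        case 2
        then have "(x1, x2) \<in> conn E" using EE[of x1 x2 x3 a] lt ab(1) c sym by simp
        then show ?thesis using c sym ns nd by metis
      next
        case 3
        then have "(a, x1) \<in> conn E" using EE[of a x1 x2 x3] lt ab(1) c sym by simp
        then show ?thesis using c sym ns nd by metis
      qed
    next
      case 2
      note c = this
      have "(a, x4) \<in> conn F" using c EF sym by (metis subsetD)
      then have "x1 \<le> a \<or> b \<le> x1" "x3 \<le> a \<or> b \<le> x3"
        using out conn_trans[OF _ lk[of x4 x1]] conn_trans[OF _ lk[of x4 x3]] by simp_all
      moreover have "a \<noteq> x1" "a \<noteq> x3" "b \<noteq> x1" "b \<noteq> x3"
        using c ns conn_refl by metis+
      ultimately consider "x1 < a" "b < x3" | "x3 < a" | "b < x1" using ab(1) lt by linarith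
      then show ?thesis
      proof cases
        case 1
        then have "(x1, a) \<in> conn E" using EE[of x1 a x3 x4] lt ab(1) c sym by simp
        then show ?thesis using c sym ns nd by metis
      next
        case 2
        then have "(x1, x2) \<in> conn E" using EE[of x1 x2 x3 b] lt ab(1) c sym by simp
        then show ?thesis using c sym ns nd by metis
      next
        case 3
        then have "(b, x1) \<in> conn E" using EE[of b x1 x2 x3] lt ab(1) c sym by simp
        then show ?thesis using c sym ns nd by metis
      qed
    next
      case 3
      note c = this
      have "(a, x1) \<in> conn F" using c EF sym by (metis subsetD)
      then have "x2 \<le> a \<or> b \<le> x2" "x4 \<le> a \<or> b \<le> x4"
        using out conn_trans[OF _ lk[of x1 x2]] conn_trans[OF _ lk[of x1 x4]] by simp_all
      moreover have "a \<noteq> x2" "a \<noteq> x4" "b \<noteq> x2" "b \<noteq> x4"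
        using c ns conn_refl by metis+
      ultimately consider "x2 < a" "b < x4" | "x4 < a" | "b < x2" using ab(1) lt by linarith
      then show ?thesis
      proof cases
        case 1
        then have "(x1, x2) \<in> conn E" using EE[of x1 x2 a x4] lt ab(1) c sym by simp
        then show ?thesis using c sym ns nd by metis
      next
        case 2
        then have "(x2, x3) \<in> conn E" using EE[of x2 x3 x4 b] lt ab(1) c sym by simp
        then show ?thesis using c sym ns nd by metis
      next
        case 3
        then have "(b, x2) \<in> conn E" using EE[of b x2 x3 x4] lt ab(1) c sym by simp
        then show ?thesis using c sym ns nd by metis
      qed
    next
      case 4
      note c = this
      have "(a, x3) \<in> conn F" using c EF sym by (metis subsetD)
      then have "x2 \<le> a \<or> b \<le> x2" "x4 \<le> a \<or> b \<le> x4"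
        using out conn_trans[OF _ lk[of x3 x2]] conn_trans[OF _ lk[of x3 x4]] by simp_all
      moreover have "a \<noteq> x2" "a \<noteq> x4" "b \<noteq> x2" "b \<noteq> x4"
        using c ns conn_refl by metis+
      ultimately consider "x2 < a" "b < x4" | "x4 < a" | "b < x2" using ab(1) lt by linarith
      then show ?thesis
      proof cases
        case 1
        then have "(x1, x2) \<in> conn E" using EE[of x1 x2 b x4] lt ab(1) c sym by simp
        then show ?thesis using c sym ns nd by metis
      next
        case 2
        then have "(x2, x3) \<in> conn E" using EE[of x2 x3 x4 a] lt ab(1) c sym by simp
        then show ?thesis using c sym ns nd by metis
      next
        case 3
        then have "(a, x2) \<in> conn E" using EE[of a x2 x3 x4] lt ab(1) c sym by simp
        then show ?thesis using c sym ns nd by metis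
      qed
    qed
  qed
qed

text \<open>\<open>i\<close> and \<open>Suc i\<close> are neighbours even if everything forms a
  single block, so \<open>nonx_insert\<close> applies with the total relation as
  \<open>F\<close>.\<close>

lemma nonx_insert_Suc:
  assumes "nonx E"
  shows "nonx (insert (i, Suc i) E)"
proof (rule nonx_insert[OF assms, where F = UNIV])
  have "conn (UNIV :: nat rel) = UNIV" using conn_edge[of _ _ "UNIV :: nat rel"] by auto
  then show "nonx UNIV" "E \<subseteq> conn UNIV" "(i, Suc i) \<in> conn UNIV" by (auto simp: nonx_def)
qed auto

text \<open>An interval partition is stored as the set of those elements that it joins to their
  predecessor.\<close>

definition bonds :: "nat set \<Rightarrow> nat rel" where
  "bonds B = {(i, j). j = Suc i \<and> j \<in> B}"

lemma bonds_empty [simp]: "bonds {} = {}"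
  by (simp add: bonds_def)

lemma bonds_insert_Suc: "bonds (insert (Suc i) B) = insert (i, Suc i) (bonds B)"
  by (auto simp: bonds_def)

lemma bonds_insert_0: "bonds (insert 0 B) = bonds B"
  by (auto simp: bonds_def)

lemma bonds_Un: "bonds (A \<union> B) = bonds A \<union> bonds B"
  by (auto simp: bonds_def)

lemma nonx_bonds: "finite B \<Longrightarrow> nonx E \<Longrightarrow> nonx (bonds B \<union> E)"
proof (induction B rule: finite_induct)
  case (insert i B)
  then show ?case by (cases i) (auto simp: bonds_insert_0 bonds_insert_Suc nonx_insert_Suc)
qed simp

text \<open>Supplies the neighbours that \<open>nonx_insert\<close> asks for. If a third point of
  the class lies between \<open>x\<close> and \<open>y\<close>, one of the two halves is still
  unconnected in \<open>E\<close>, as otherwise \<open>x\<close> and \<open>y\<close> would be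
  connected; so the pair can be shortened.\<close>

lemma ex_conn_gap:
  fixes x y :: nat
  assumes "(x, y) \<in> conn F" "(x, y) \<notin> conn E"
  shows "\<exists>a b. a < b \<and> (a, b) \<in> conn F \<and> (a, b) \<notin> conn E \<and> (\<forall>z. a < z \<and> z < b \<longrightarrow> (a, z) \<notin> conn F)"
proof -
  have main: "x < y \<Longrightarrow> (x, y) \<in> conn F \<Longrightarrow> (x, y) \<notin> conn E \<Longrightarrow> ?thesis" for x y
  proof (induction "y - x" arbitrary: x y rule: less_induct)
    case less
    show ?case
    proof (cases "\<exists>z. x < z \<and> z < y \<and> (x, z) \<in> conn F")
      case True
      then obtain z where z: "x < z" "z < y" "(x, z) \<in> conn F" by auto
      then have "(z, y) \<in> conn F" using less.prems by (meson conn_trans conn_sym)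
      moreover have "(x, z) \<notin> conn E \<or> (z, y) \<notin> conn E" using less.prems by (meson conn_trans)
      ultimately show ?thesis
        using less.hyps[of z x] less.hyps[of y z] z by auto
    next
      case False
      then show ?thesis using less.prems by blast
    qed
  qed
  have "x \<noteq> y" using assms(2) by auto
  then show ?thesis
    using main[of x y] main[of y x] assms by (meson conn_sym linorder_neqE_nat)
qed

section \<open>Order and covering relation in terms of generated equivalences\<close>

lemma NC_less_iff:
  "NC_less n P Q \<longleftrightarrow> P \<in> NC n \<and> Q \<in> NC n \<and> same_block P \<subseteq> same_block Q \<and> P \<noteq> Q"
proof -
  have "refines {1..n} P Q \<longleftrightarrow> same_block P \<subseteq> same_block Q" if "P \<in> NC n" "Q \<in> NC n"
  proof
    show "same_block P \<subseteq> same_block Q" if "refines {1..n} P Q"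
      using that unfolding refines_def same_block_def by fast
  next
    assume sub: "same_block P \<subseteq> same_block Q"
    note PQ = NC_D(1)[OF that(1)] NC_D(1)[OF that(2)]
    have "\<exists>Y\<in>Q. X \<subseteq> Y" if X: "X \<in> P" for X
    proof -
      obtain x where x: "x \<in> X" using PQ(1) X unfolding partition_on_def by (metis all_not_in_conv)
      then have "(x, x) \<in> same_block Q" using sub X unfolding same_block_def by blast
      then obtain Y where Y: "Y \<in> Q" "x \<in> Y" by (auto simp: same_block_iff)
      have "y \<in> Y" if "y \<in> X" for y
      proof -
        have "(x, y) \<in> same_block Q" using sub X x that unfolding same_block_def by blast
        then obtain Z where "Z \<in> Q" "x \<in> Z" "y \<in> Z" by (auto simp: same_block_iff)
        moreover from this have "Z = Y" using Y PQ(2) unfolding partition_on_def disjoint_def by blast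
        ultimately show ?thesis by simp
      qed
      then show ?thesis using Y by blast
    qed
    then show "refines {1..n} P Q" using PQ by (simp add: refines_def)
  qed
  then show ?thesis unfolding NC_less_def by blast
qed

lemma NC_conn_subset_iff:
  assumes "P \<in> NC n" "Q \<in> NC n"
  shows "same_block P \<subseteq> same_block Q \<longleftrightarrow> conn (same_block P) \<subseteq> conn (same_block Q)"
proof
  assume sub: "conn (same_block P) \<subseteq> conn (same_block Q)"
  show "same_block P \<subseteq> same_block Q"
  proof
    fix p assume p: "p \<in> same_block P"
    obtain x y where [simp]: "p = (x, y)" by (cases p)
    have xy: "x \<in> {1..n}" "(x, y) \<in> conn (same_block Q)"
      using p NC_D(3)[OF assms(1)] sub conn_edge[of x y] by auto
    then obtain X where "X \<in> Q" "x \<in> X"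
      using NC_D(1)[OF assms(2)] unfolding partition_on_def by blast
    then have "(x, x) \<in> same_block Q" by (auto simp: same_block_iff)
    then show "p \<in> same_block Q"
      using xy unfolding conn_same_block[OF NC_D(1)[OF assms(2)]] by auto
  qed
qed (rule conn_mono)

lemma NC_eqI:
  assumes "P \<in> NC n" "Q \<in> NC n" "conn (same_block P) = conn (same_block Q)"
  shows "P = Q"
  using comps_cong[OF assms(3)] NC_D(4)[OF assms(1)] NC_D(4)[OF assms(2)] by metis

lemma NC_less_iff_conn:
  "NC_less n P Q \<longleftrightarrow> P \<in> NC n \<and> Q \<in> NC n \<and> conn (same_block P) \<subset> conn (same_block Q)"
  using NC_conn_subset_iff[of P n Q] NC_eqI[of P n Q] unfolding NC_less_iff psubset_eq by blast

text \<open>One can climb from \<open>P\<close> towards \<open>Q\<close> by a single pair: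
  neighbours in a block of \<open>Q\<close> that \<open>P\<close> does not yet join can be joined
  without a crossing.\<close>

lemma NC_less_insert:
  assumes "NC_less n P Q"
  obtains a b R where "a \<in> {1..n}" "b \<in> {1..n}" "(a, b) \<notin> conn (same_block P)" "R \<in> NC n"
    "conn (same_block R) = conn (insert (a, b) (same_block P))"
    "conn (same_block R) \<subseteq> conn (same_block Q)"
proof -
  let ?P = "same_block P" and ?Q = "same_block Q"
  have PQ: "P \<in> NC n" "Q \<in> NC n" "conn ?P \<subset> conn ?Q" using assms by (auto simp: NC_less_iff_conn)
  then obtain x y where "(x, y) \<in> conn ?Q" "(x, y) \<notin> conn ?P" by auto
  from ex_conn_gap[OF this] obtain a b where ab: "a < b" "(a, b) \<in> conn ?Q" "(a, b) \<notin> conn ?P"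
    "\<And>z. a < z \<Longrightarrow> z < b \<Longrightarrow> (a, z) \<notin> conn ?Q" by blast
  have mem: "a \<in> {1..n}" "b \<in> {1..n}"
    using conn_field[OF ab(2) NC_D(3)[OF PQ(2)]] ab(1) by auto
  have PQ': "?P \<subseteq> conn ?Q" using PQ(3) conn_edge[of _ _ ?P] by fast
  have sub: "insert (a, b) ?P \<subseteq> {1..n} \<times> {1..n}" using mem NC_D(3)[OF PQ(1)] by auto
  have "nonx (insert (a, b) ?P)"
    using nonx_insert[OF NC_D(2)[OF PQ(1)] NC_D(2)[OF PQ(2)] PQ' ab(1,2,4)] by blast
  then have "comps {1..n} (insert (a, b) ?P) \<in> NC n" by (rule comps_in_NC[OF sub])
  moreover have "conn (insert (a, b) ?P) \<subseteq> conn ?Q" using ab PQ' by (intro conn_least) auto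
  ultimately show ?thesis
    using that[OF mem ab(3)] conn_same_block_comps[OF sub] by metis
qed

text \<open>An exchange argument: if \<open>(c, d)\<close> becomes connected only through
  \<open>(a, b)\<close>, then adding \<open>(c, d)\<close> instead connects \<open>a\<close> and
  \<open>b\<close>. Hence whatever lies strictly above \<open>P\<close> and below \<open>R\<close>
  already contains \<open>R\<close>.\<close>

lemma NC_covers_insert:
  assumes "P \<in> NC n" "R \<in> NC n" "(a, b) \<notin> conn (same_block P)"
    and R: "conn (same_block R) = conn (insert (a, b) (same_block P))"
  shows "NC_covers n P R"
proof -
  let ?P = "same_block P"
  have ab: "(a, b) \<in> conn (same_block R)" unfolding R by (simp add: conn_edge)
  have "conn ?P \<subseteq> conn (same_block R)" unfolding R by (intro conn_mono) auto
  then have "NC_less n P R" using assms ab by (auto simp: NC_less_iff_conn)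
  moreover have False if S: "NC_less n P S" "NC_less n S R" for S
  proof -
    obtain c d T where T: "(c, d) \<notin> conn ?P" "conn (same_block T) = conn (insert (c, d) ?P)"
      "conn (same_block T) \<subseteq> conn (same_block S)"
      using NC_less_insert[OF S(1)] by metis
    have "(c, d) \<in> conn (same_block S)" using T(2,3) conn_edge[of c d "insert (c, d) ?P"] by auto
    then have "(c, d) \<in> conn (insert (a, b) ?P)" using S(2) R by (auto simp: NC_less_iff_conn)
    then have "(a, b) \<in> conn (insert (c, d) ?P)"
      using T(1) unfolding conn_insert_iff by (meson conn_sym)
    then have "(a, b) \<in> conn (same_block S)" using T by blast
    moreover have "?P \<subseteq> conn (same_block S)"
      using S(1) conn_edge[of _ _ ?P] unfolding NC_less_iff_conn by fast
    ultimately have "conn (same_block R) \<subseteq> conn (same_block S)"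
      unfolding R by (intro conn_least) auto
    then show False using S(2) by (auto simp: NC_less_iff_conn)
  qed
  ultimately show ?thesis unfolding NC_covers_def by blast
qed

lemma NC_covers_ex_insert:
  assumes "NC_covers n P Q"
  obtains a b where "a \<in> {1..n}" "b \<in> {1..n}" "(a, b) \<notin> conn (same_block P)"
    "conn (same_block Q) = conn (insert (a, b) (same_block P))"
proof -
  have PQ: "NC_less n P Q" using assms by (simp add: NC_covers_def)
  from NC_less_insert[OF PQ] obtain a b R where R: "a \<in> {1..n}" "b \<in> {1..n}"
    "(a, b) \<notin> conn (same_block P)" "R \<in> NC n"
    "conn (same_block R) = conn (insert (a, b) (same_block P))"
    "conn (same_block R) \<subseteq> conn (same_block Q)" by metis
  have "NC_less n P R"
    using NC_covers_insert[OF _ R(4,3,5)] PQ by (auto simp: NC_covers_def NC_less_def)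
  then have "\<not> NC_less n R Q" using assms by (auto simp: NC_covers_def)
  then have "conn (same_block R) = conn (same_block Q)"
    using R PQ by (auto simp: NC_less_iff_conn)
  then show ?thesis using that R by metis
qed

lemma card_NC_insert:
  assumes "P \<in> NC n" "R \<in> NC n" "a \<in> {1..n}" "b \<in> {1..n}" "(a, b) \<notin> conn (same_block P)"
    and R: "conn (same_block R) = conn (insert (a, b) (same_block P))"
  shows "card P = card R + 1"
  using card_comps_insert[of "{1..n}" a b "same_block P"] comps_cong[OF R, of "{1..n}"]
    assms NC_D(4) by auto

section \<open>Walks along chains and the distance formula\<close>

text \<open>Each step up merges two blocks, so the walk has length \<open>card P - card Q\<close>.
  Its reversal is built along with it, because the walk through the join goes up from one partition
  and down to the other.\<close>

lemma awalk_between: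
  assumes "P \<in> NC n" "Q \<in> NC n" "conn (same_block P) \<subseteq> conn (same_block Q)"
  shows "\<exists>p q. pre_digraph.awalk (with_proj (hasse_graph n)) P p Q \<and>
    pre_digraph.awalk (with_proj (hasse_graph n)) Q q P \<and>
    length p + card Q = card P \<and> length q = length p"
  using assms
proof (induction "card P" arbitrary: P rule: less_induct)
  case less
  interpret graph "with_proj (hasse_graph n)" by (rule graph_hasse_graph)
  show ?case
  proof (cases "P = Q")
    case True
    then have "awalk P [] Q" "awalk Q [] P"
      using less.prems unfolding awalk_Nil_iff by (auto simp: hasse_graph_def)
    then show ?thesis using True by (intro exI[of _ "[]"]) simp
  next
    case False
    then have "NC_less n P Q" using less.prems NC_eqI by (auto simp: NC_less_iff_conn)
    from NC_less_insert[OF this] obtain a b R where R: "a \<in> {1..n}" "b \<in> {1..n}"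
      "(a, b) \<notin> conn (same_block P)" "R \<in> NC n"
      "conn (same_block R) = conn (insert (a, b) (same_block P))"
      "conn (same_block R) \<subseteq> conn (same_block Q)" by metis
    have cover: "NC_covers n P R" using NC_covers_insert[OF _ R(4,3,5)] less.prems by blast
    have card: "card P = card R + 1" using card_NC_insert[OF _ R(4,1,2,3,5)] less.prems by blast
    obtain p q where pq: "awalk R p Q" "awalk Q q R" "length p + card Q = card R" "length q = length p"
      using less.hyps[of R] card R less.prems by auto
    have "awalk P ((P, R) # p) Q"
      using pq(1) cover less.prems(1) R(4) unfolding awalk_Cons_iff by (simp add: hasse_graph_def)
    moreover have "awalk R [(R, P)] P"
      using cover less.prems(1) R(4) unfolding awalk_Cons_iff awalk_Nil_iff by (simp add: hasse_graph_def)
    then have "awalk Q (q @ [(R, P)]) P" using pq(2) by (rule awalk_appendI[rotated])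
    ultimately show ?thesis
      using pq card by (intro exI[of _ "(P, R) # p"] exI[of _ "q @ [(R, P)]"]) simp
  qed
qed

theorem hasse_dist_eq_join:
  assumes P: "P \<in> NC n" and Q: "Q \<in> NC n"
    and J: "comps {1..n} (same_block P \<union> same_block Q) \<in> NC n"
  shows "hasse_dist n P Q =
    real (card P) + real (card Q) - 2 * real (card (comps {1..n} (same_block P \<union> same_block Q)))"
proof -
  interpret graph "with_proj (hasse_graph n)" by (rule graph_hasse_graph)
  \<comment> \<open>For an intermediate vertex \<open>S\<close> the partition \<open>j S\<close> may
    have crossings; the lower bound only counts its blocks. That \<open>j Q\<close> is a vertex
    matters for the walk that attains the bound.\<close>
  define j where "j S = comps {1..n} (same_block P \<union> same_block S)" for S
  define f where "f S = int (card P) + int (card S) - 2 * int (card (j S))" for S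
  have arc: "\<bar>f R - f S\<bar> \<le> 1" if cov: "NC_covers n R S" for R S
  proof -
    obtain a b where ab: "a \<in> {1..n}" "b \<in> {1..n}" "(a, b) \<notin> conn (same_block R)"
      and S: "conn (same_block S) = conn (insert (a, b) (same_block R))"
      using NC_covers_ex_insert[OF cov] by metis
    have RS: "R \<in> NC n" "S \<in> NC n" using cov by (auto simp: NC_covers_def NC_less_def)
    have "card R = card S + 1" by (rule card_NC_insert[OF RS ab S])
    \<comment> \<open>From \<open>R\<close> up to \<open>S\<close> the number of blocks falls by one
      and that of the join by zero or one, so \<open>f\<close> changes by -1 or 1.\<close>
    moreover have "j S = comps {1..n} (insert (a, b) (same_block P \<union> same_block R))"
      unfolding j_def using conn_Un_cong[OF refl S] by (intro comps_cong) simp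
    then have "card (j S) \<le> card (j R)" "card (j R) \<le> card (j S) + 1"
      using card_comps_insert[of "{1..n}" a b "same_block P \<union> same_block R"] ab
      unfolding j_def[of R] by (auto split: if_splits)
    ultimately show ?thesis unfolding f_def by linarith
  qed
  have lower: "\<bar>f R - f S\<bar> \<le> int (length p)" if "awalk R p S" for R p S
    using that
  proof (induction p arbitrary: R)
    case (Cons e p)
    then obtain T where T: "e = (R, T)" "awalk T p S" "NC_covers n R T \<or> NC_covers n T R"
      unfolding awalk_Cons_iff by (auto simp: hasse_graph_def)
    then have "\<bar>f R - f T\<bar> \<le> 1" using arc[of R T] arc[of T R] by (auto simp: abs_minus_commute)
    then show ?case using Cons.IH[OF T(2)] by simp
  next
    case Nil
    then show ?case unfolding awalk_Nil_iff by simp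
  qed
  have jP: "j P = P" using NC_D(4)[OF P] by (simp add: j_def)
  have low: "f Q \<le> int (length p)" if "awalk P p Q" for p
    using lower[OF that] unfolding f_def jP by linarith
  have sub: "same_block P \<union> same_block Q \<subseteq> {1..n} \<times> {1..n}" using NC_D(3) P Q by blast
  have "conn (same_block P) \<subseteq> conn (same_block (j Q))" "conn (same_block Q) \<subseteq> conn (same_block (j Q))"
    unfolding j_def conn_same_block_comps[OF sub] by (intro conn_mono; simp)+
  with awalk_between[OF P J] awalk_between[OF Q J] obtain p q
    where p: "awalk P p (j Q)" "length p + card (j Q) = card P"
      and q: "awalk (j Q) q Q" "length q + card (j Q) = card Q"
    unfolding j_def by metis
  have w: "awalk P (p @ q) Q" using p(1) q(1) by (rule awalk_appendI)
  have len: "int (length (p @ q)) = f Q" using p(2) q(2) by (simp add: f_def)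
  have "(LEAST k. \<exists>p. awalk P p Q \<and> length p = k) = length (p @ q)"
  proof (rule Least_equality)
    fix k assume "\<exists>p. awalk P p Q \<and> length p = k"
    then show "length (p @ q) \<le> k" using low len by force
  qed (use w in blast)
  then have "hasse_dist n P Q = real (length (p @ q))"
    using hasse_dist_eq_shortest_walk[OF P Q] by simp
  also have "\<dots> = real_of_int (f Q)" using len by (metis of_int_of_nat_eq)
  finally show ?thesis by (simp add: f_def j_def)
qed

section \<open>Trees for pairs of an interval partition and a non-crossing partition\<close>

definition opt :: "bool \<Rightarrow> 'a \<Rightarrow> 'a set" where
  "opt c e = (if c then {e} else {})"

lemma opt_simps [simp]: "opt True e = {e}" "opt False e = {}"
  by (auto simp: opt_def)

lemma in_opt_iff [simp]: "x \<in> opt c e \<longleftrightarrow> c \<and> x = e"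
  by (auto simp: opt_def)

lemma card_comps_opt:
  assumes "finite V" "c \<Longrightarrow> a \<in> V" "c \<Longrightarrow> b \<in> V"
  shows "int (card (comps V (E \<union> opt c (a, b)))) =
    int (card (comps V E)) - of_bool (c \<and> (a, b) \<notin> conn E)"
  using card_comps_insert[of V a b E] assms by (cases c) auto

text \<open>All three graphs on \<open>{a..<k}\<close> attached to a tree have this shape: the elements
  of \<open>{Suc a..<m}\<close> and \<open>{m..<k}\<close> carry the graphs of the two subtrees.\<close>

definition glue :: "nat \<Rightarrow> nat \<Rightarrow> nat rel \<Rightarrow> nat rel \<Rightarrow> bool \<Rightarrow> bool \<Rightarrow> bool \<Rightarrow> nat rel" where
  "glue a m El Er p q r = El \<union> Er \<union> opt p (a, m) \<union> opt q (a, Suc a) \<union> opt r (m - 1, m)"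

lemma conn_glue_cong:
  assumes "conn El = conn El'" "conn Er = conn Er'"
  shows "conn (glue a m El Er p q r) = conn (glue a m El' Er' p q r)"
  unfolding glue_def by (intro conn_Un_cong assms refl)

locale gluing =
  fixes a m k :: nat and El Er :: "nat rel" and p q r :: bool
  assumes am: "a < m" and mk: "m \<le> k"
    and El: "El \<subseteq> {Suc a..<m} \<times> {Suc a..<m}" and Er: "Er \<subseteq> {m..<k} \<times> {m..<k}"
    and p: "p \<Longrightarrow> m < k" and q: "q \<Longrightarrow> Suc a < k" and r: "r \<Longrightarrow> m < k"
begin

abbreviation "G \<equiv> glue a m El Er p q r"

lemma glue_subset: "G \<subseteq> {a..<k} \<times> {a..<k}"
proof -
  have "El \<subseteq> {a..<k} \<times> {a..<k}" "Er \<subseteq> {a..<k} \<times> {a..<k}" using El Er am mk by fastforce+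
  then show ?thesis unfolding glue_def using am p q r by (intro Un_least) auto
qed

lemma El_D: "(x, y) \<in> El \<Longrightarrow> (x, y) \<in> conn El \<and> Suc a \<le> x \<and> x < m \<and> Suc a \<le> y \<and> y < m"
  using El conn_edge[of x y El] by auto

lemma Er_D: "(x, y) \<in> Er \<Longrightarrow> (x, y) \<in> conn Er \<and> m \<le> x \<and> x < k \<and> m \<le> y \<and> y < k"
  using Er conn_edge[of x y Er] by auto

text \<open>Every edge that enters the right part ends in \<open>m\<close>. Contracting all that
  lies below \<open>m\<close> onto \<open>m\<close> therefore makes loops of all edges outside
  \<open>Er\<close>.\<close>

lemma conn_glue_right:
  assumes "x = a \<and> p \<or> m \<le> x" "m \<le> y"
  shows "(x, y) \<in> conn G \<longleftrightarrow> (if x = a then m else x, y) \<in> conn Er"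
proof
  assume "(x, y) \<in> conn G"
  then have "((if m \<le> x then x else m), (if m \<le> y then y else m)) \<in> conn Er"
    by (rule conn_hom[where h = "\<lambda>z. if m \<le> z then z else m"])
      (use am in \<open>auto simp: glue_def le_Suc_eq dest!: El_D Er_D\<close>)
  then show "(if x = a then m else x, y) \<in> conn Er"
    using assms am by (auto split: if_splits)
next
  assume xy: "(if x = a then m else x, y) \<in> conn Er"
  have "conn Er \<subseteq> conn G" by (rule conn_mono) (auto simp: glue_def)
  moreover have "p \<Longrightarrow> (a, m) \<in> conn G" by (rule conn_edge) (auto simp: glue_def)
  ultimately show "(x, y) \<in> conn G"
    using xy assms(1) am conn_trans[of a m G y] by (cases "x = a") auto
qed

text \<open>Without the edge \<open>(m - 1, m)\<close> the left part is attached at most through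
  \<open>Suc a\<close>, onto which its complement can be contracted.\<close>

lemma conn_glue_left:
  assumes "\<not> r" "Suc a \<le> x" "x < m" "Suc a \<le> y" "y < m"
  shows "(x, y) \<in> conn G \<longleftrightarrow> (x, y) \<in> conn El"
proof
  let ?h = "\<lambda>z. if Suc a \<le> z \<and> z < m then z else Suc a"
  assume "(x, y) \<in> conn G"
  then have "(?h x, ?h y) \<in> conn El"
    by (rule conn_hom[where h = ?h])
      (use assms in \<open>auto simp: glue_def dest!: El_D Er_D\<close>)
  then show "(x, y) \<in> conn El" using assms by simp
next
  have "conn El \<subseteq> conn G" by (rule conn_mono) (auto simp: glue_def)
  then show "(x, y) \<in> conn El \<Longrightarrow> (x, y) \<in> conn G" by blast
qed

lemma conn_glue_cross:
  assumes "\<not> r" "\<not> q" "Suc a \<le> x" "x < m" "(x, y) \<in> conn G"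
  shows "Suc a \<le> y \<and> y < m"
proof -
  let ?h = "\<lambda>z. Suc a \<le> z \<and> z < m"
  have "(?h x, ?h y) \<in> conn {}"
    using assms(5) by (rule conn_hom) (use assms in \<open>auto simp: glue_def dest!: El_D Er_D\<close>)
  then show ?thesis using assms by simp
qed

lemma conn_glue_root:
  assumes "\<not> p" "\<not> r" "\<not> q" "(a, y) \<in> conn G"
  shows "y = a"
proof -
  let ?h = "\<lambda>z. z = a"
  have "(?h a, ?h y) \<in> conn {}"
    using assms(4) by (rule conn_hom) (use assms am in \<open>auto simp: glue_def dest!: El_D Er_D\<close>)
  then show ?thesis by simp
qed

lemma conn_glue_root_left:
  assumes "\<not> p" "\<not> r" "Suc a \<le> y" "y < m"
  shows "(a, y) \<in> conn G \<longleftrightarrow> q \<and> (Suc a, y) \<in> conn El"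
proof (cases q)
  case True
  then have e: "(a, Suc a) \<in> conn G" by (intro conn_edge) (auto simp: glue_def)
  then have "(a, y) \<in> conn G \<longleftrightarrow> (Suc a, y) \<in> conn G"
    using conn_trans conn_sym by metis
  then show ?thesis using True conn_glue_left[of "Suc a" y] assms by simp
next
  case False
  then show ?thesis using conn_glue_root[of y] assms by auto
qed

text \<open>The three optional edges are added one by one, and each costs a component unless its
  ends are already connected. For \<open>(m - 1, m)\<close> this happens if it coincides with an
  edge already present (\<open>Suc a = m\<close>) or closes the cycle through \<open>a\<close>,
  \<open>Suc a\<close>, the left part and \<open>m\<close>.\<close>

lemma card_glue:
  "int (card (comps {a..<k} G)) =
    1 + int (card (comps {Suc a..<m} El)) + int (card (comps {m..<k} Er))
    - of_bool p - of_bool (q \<and> \<not> (p \<and> Suc a = m))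
    - of_bool (r \<and> \<not> (p \<and> (Suc a = m \<or> q \<and> (Suc a, m - 1) \<in> conn El)) \<and> \<not> (Suc a = m \<and> q))"
proof -
  let ?c = "\<lambda>E. int (card (comps {a..<k} E))"
  let ?E0 = "El \<union> Er"
  let ?E1 = "?E0 \<union> opt p (a, m)"
  let ?E2 = "?E1 \<union> opt q (a, Suc a)"
  have V: "{a..<k} = {a} \<union> ({Suc a..<m} \<union> {m..<k})" using am mk by auto
  have "card (comps {a..<k} ({} \<union> ?E0)) = card (comps {a} ({} :: nat rel)) + card (comps ({Suc a..<m} \<union> {m..<k}) ?E0)"
    unfolding V by (rule card_comps_Un) (use El Er am in fastforce)+
  also have "card (comps ({Suc a..<m} \<union> {m..<k}) ?E0) = card (comps {Suc a..<m} El) + card (comps {m..<k} Er)"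
    by (rule card_comps_Un) (use El Er in auto)
  also have "card (comps {a} ({} :: nat rel)) = 1" by (simp add: comps_def)
  finally have c0: "?c ?E0 = 1 + int (card (comps {Suc a..<m} El)) + int (card (comps {m..<k} Er))" by simp
  have n1: "(a, m) \<notin> conn ?E0"
  proof
    assume "(a, m) \<in> conn ?E0"
    then have "(a = a, m = a) \<in> conn {}"
      by (rule conn_hom[where h = "\<lambda>z. z = a"]) (use am in \<open>auto dest!: El_D Er_D\<close>)
    then show False using am by simp
  qed
  have c1: "?c ?E1 = ?c ?E0 - of_bool p"
    using card_comps_opt[of "{a..<k}" p a m ?E0] n1 p am by (cases p) auto
  have n2: "(a, Suc a) \<in> conn ?E1 \<longleftrightarrow> p \<and> Suc a = m" if q
  proof
    assume e: "(a, Suc a) \<in> conn ?E1"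
    have "\<not> Suc a < m"
    proof
      assume "Suc a < m"
      let ?h = "\<lambda>z. Suc a \<le> z \<and> z < m"
      have "(?h a, ?h (Suc a)) \<in> conn {}"
        using e by (rule conn_hom[where h = ?h]) (use am in \<open>auto dest!: El_D Er_D\<close>)
      then show False using \<open>Suc a < m\<close> by simp
    qed
    then have "Suc a = m" using am by simp
    moreover from this have p using e n1 by (cases p) auto
    ultimately show "p \<and> Suc a = m" by simp
  qed (auto intro: conn_edge)
  have c2: "?c ?E2 = ?c ?E1 - of_bool (q \<and> \<not> (p \<and> Suc a = m))"
    using card_comps_opt[of "{a..<k}" q a "Suc a" ?E1] n2 q am by (cases q) auto
  have n3: "(m - 1, m) \<in> conn ?E2 \<longleftrightarrow>
      p \<and> (Suc a = m \<or> q \<and> (Suc a, m - 1) \<in> conn El) \<or> Suc a = m \<and> q" if r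
  proof
    assume e: "(m - 1, m) \<in> conn ?E2"
    show "p \<and> (Suc a = m \<or> q \<and> (Suc a, m - 1) \<in> conn El) \<or> Suc a = m \<and> q"
    proof (cases "Suc a = m")
      case True
      show ?thesis
      proof (rule ccontr)
        assume "\<not> ?thesis"
        then have "\<not> p" "\<not> q" using True by auto
        then show False using e n1 True by auto
      qed
    next
      case False
      then have lt: "Suc a < m" using am by simp
      \<comment> \<open>Without \<open>(a, m)\<close> no edge of \<open>?E2\<close> leads from below
        \<open>m\<close> to \<open>m\<close> or beyond; without \<open>(a, Suc a)\<close> the left
        part is isolated.\<close>
      have p
      proof (rule ccontr)
        assume "\<not> p"
        let ?h = "\<lambda>z. z < m"
        have "(?h (m - 1), ?h m) \<in> conn {}"
          using e by (rule conn_hom[where h = ?h]) (use \<open>\<not> p\<close> lt in \<open>auto dest!: El_D Er_D\<close>)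
        then show False using lt by simp
      qed
      moreover have q
      proof (rule ccontr)
        assume "\<not> q"
        let ?h = "\<lambda>z. Suc a \<le> z \<and> z < m"
        have "(?h (m - 1), ?h m) \<in> conn {}"
          using e by (rule conn_hom[where h = ?h]) (use \<open>\<not> q\<close> lt in \<open>auto dest!: El_D Er_D\<close>)
        then show False using lt by simp
      qed
      moreover have "(Suc a, m - 1) \<in> conn El"
      proof -
        \<comment> \<open>Contraction of the complement of the left part onto \<open>Suc a\<close>;
          in particular \<open>m\<close> goes to \<open>Suc a\<close>.\<close>
        let ?h = "\<lambda>z. if Suc a \<le> z \<and> z < m then z else Suc a"
        have "(?h (m - 1), ?h m) \<in> conn El"
          using e by (rule conn_hom[where h = ?h]) (use lt in \<open>auto dest!: El_D Er_D\<close>)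
        moreover have "Suc a \<le> m - 1 \<and> m - 1 < m" "\<not> (Suc a \<le> m \<and> m < m)" using lt by auto
        ultimately have "(m - 1, Suc a) \<in> conn El" by (simp only: simp_thms if_True if_False)
        then show ?thesis by (rule conn_sym)
      qed
      ultimately show ?thesis by simp
    qed
  next
    assume H: "p \<and> (Suc a = m \<or> q \<and> (Suc a, m - 1) \<in> conn El) \<or> Suc a = m \<and> q"
    show "(m - 1, m) \<in> conn ?E2"
    proof (cases "Suc a = m")
      case True
      then have "(m - 1, m) \<in> ?E2" using H by auto
      then show ?thesis by (rule conn_edge)
    next
      case False
      then have "(a, m) \<in> conn ?E2" "(a, Suc a) \<in> conn ?E2" "(Suc a, m - 1) \<in> conn ?E2"
        using H conn_mono[of El ?E2] by (auto intro: conn_edge)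
      then show ?thesis by (meson conn_sym conn_trans)
    qed
  qed
  have "?c G = ?c ?E2 - of_bool (r \<and> (m - 1, m) \<notin> conn ?E2)"
    unfolding glue_def by (rule card_comps_opt) (use r am in auto)
  then show ?thesis using c0 c1 c2 n3 by auto
qed

end

text \<open>A tree with \<^term>\<open>n\<close> nodes encodes a non-crossing partition of \<open>n\<close> consecutive numbers
  together with an interval partition. In \<open>Nd b l r\<close> the root is the least element \<open>a\<close>; if
  \<open>r \<noteq> Lf\<close>, the next element \<open>m\<close> of its block is the root of \<open>r\<close>, and \<open>l\<close> describes the
  elements strictly between \<open>a\<close> and \<open>m\<close>. If \<open>r = Lf\<close>, the block of \<open>a\<close> is \<open>{a}\<close> and \<open>l\<close>
  describes the rest. The flag \<open>b\<close> says whether the interval partition joins \<open>a\<close> to its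
  predecessor; at the root of the whole tree, where there is none, it is ignored or required to
  be \<open>False\<close>. Unlike a flag for the successor, it does not interfere with the recursion.\<close>

datatype ct = Lf | Nd bool ct ct

lemma size_eq_0_iff [simp]: "size t = 0 \<longleftrightarrow> t = Lf"
  by (cases t) auto

fun root_bond :: "ct \<Rightarrow> bool" where
  "root_bond Lf = False"
| "root_bond (Nd b l r) = b"

fun nc_edges :: "nat \<Rightarrow> ct \<Rightarrow> nat rel" where
  "nc_edges a Lf = {}"
| "nc_edges a (Nd b l r) = glue a (Suc a + size l) (nc_edges (Suc a) l)
     (nc_edges (Suc a + size l) r) (r \<noteq> Lf) False False"

fun bonded :: "nat \<Rightarrow> ct \<Rightarrow> nat set" where
  "bonded a Lf = {}"
| "bonded a (Nd b l r) = opt b a \<union> bonded (Suc a) l \<union> bonded (Suc a + size l) r"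

text \<open>The flag at the root of \<open>t\<close> concerns the predecessor of \<open>a\<close>,
  which is not a vertex here; for a subtree, that edge is supplied by the parent node.\<close>

definition int_edges :: "nat \<Rightarrow> ct \<Rightarrow> nat rel" where
  "int_edges a t = bonds (bonded a t - {a})"

lemma bonded_subset: "bonded a t \<subseteq> {a..<a + size t}"
  by (induction a t rule: bonded.induct) (auto simp: opt_def split: if_splits)

lemma bonded_root: "a \<in> bonded a t \<longleftrightarrow> root_bond t"
proof (cases t)
  case (Nd b l r)
  then show ?thesis using bonded_subset[of "Suc a" l] bonded_subset[of "Suc a + size l" r] by auto
qed auto

lemma int_edges_Lf [simp]: "int_edges a Lf = {}"
  by (simp add: int_edges_def)

lemma int_edges_Nd [simp]:
  "int_edges a (Nd b l r) = glue a (Suc a + size l) (int_edges (Suc a) l)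
     (int_edges (Suc a + size l) r) False (root_bond l) (root_bond r)"
proof -
  let ?m = "Suc a + size l"
  have l: "bonded (Suc a) l = (bonded (Suc a) l - {Suc a}) \<union> opt (root_bond l) (Suc a)"
    using bonded_root[of "Suc a" l] by auto
  have r: "bonded ?m r = (bonded ?m r - {?m}) \<union> opt (root_bond r) ?m"
    using bonded_root[of ?m r] by auto
  have "bonded a (Nd b l r) - {a} = bonded (Suc a) l \<union> bonded ?m r"
    using bonded_subset[of "Suc a" l] bonded_subset[of ?m r] by auto
  then have "bonded a (Nd b l r) - {a} = (bonded (Suc a) l - {Suc a}) \<union> (bonded ?m r - {?m})
      \<union> opt (root_bond l) (Suc a) \<union> opt (root_bond r) ?m"
    using l r by blast
  moreover have "bonds (opt c (Suc i)) = opt c (i, Suc i)" for c i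
    by (auto simp: bonds_def)
  ultimately show ?thesis
    unfolding int_edges_def glue_def by (simp add: bonds_Un)
qed

definition pair_edges :: "nat \<Rightarrow> ct \<Rightarrow> nat rel" where
  "pair_edges a t = int_edges a t \<union> nc_edges a t"

lemma pair_edges_Lf [simp]: "pair_edges a Lf = {}"
  by (simp add: pair_edges_def)

lemma pair_edges_Nd [simp]:
  "pair_edges a (Nd b l r) = glue a (Suc a + size l) (pair_edges (Suc a) l)
     (pair_edges (Suc a + size l) r) (r \<noteq> Lf) (root_bond l) (root_bond r)"
  by (auto simp: pair_edges_def glue_def)

lemma glue_node_subset:
  assumes "El \<subseteq> {Suc a..<Suc a + size l} \<times> {Suc a..<Suc a + size l}"
    and "Er \<subseteq> {Suc a + size l..<Suc a + size l + size r} \<times> {Suc a + size l..<Suc a + size l + size r}"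
    and "p \<Longrightarrow> r \<noteq> Lf" "q \<Longrightarrow> l \<noteq> Lf" "q' \<Longrightarrow> r \<noteq> Lf"
  shows "gluing a (Suc a + size l) (a + size (Nd b l r)) El Er p q q'"
  using assms size_eq_0_iff[of r] size_eq_0_iff[of l] by unfold_locales (auto simp del: size_eq_0_iff)

lemma nc_edges_subset: "nc_edges a t \<subseteq> {a..<a + size t} \<times> {a..<a + size t}"
proof (induction a t rule: nc_edges.induct)
  case (2 a b l r)
  show ?case unfolding nc_edges.simps
    by (rule gluing.glue_subset[OF glue_node_subset[OF 2]]) auto
qed auto

lemma int_edges_subset: "int_edges a t \<subseteq> {a..<a + size t} \<times> {a..<a + size t}"
proof (induction a t rule: nc_edges.induct)
  case (2 a b l r)
  show ?case unfolding int_edges_Nd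
    by (rule gluing.glue_subset[OF glue_node_subset[OF 2]]) auto
qed auto

lemma pair_edges_subset: "pair_edges a t \<subseteq> {a..<a + size t} \<times> {a..<a + size t}"
  using nc_edges_subset int_edges_subset by (simp add: pair_edges_def)

lemmas gluing_nc = glue_node_subset[OF nc_edges_subset nc_edges_subset]
lemmas gluing_int = glue_node_subset[OF int_edges_subset int_edges_subset]
lemmas gluing_pair = glue_node_subset[OF pair_edges_subset pair_edges_subset]

fun ends :: "ct \<Rightarrow> bool" where
  "ends Lf = False"
| "ends (Nd b l r) = (if r \<noteq> Lf then ends r else l \<noteq> Lf \<longrightarrow> root_bond l \<and> ends l)"

text \<open>If \<open>r\<close> is not empty, it contains the last element, and \<open>a\<close> is
  linked to the first element of \<open>r\<close>. Otherwise the last element is \<open>a\<close>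
  itself or belongs to \<open>l\<close>, which \<open>a\<close> reaches only over the edge to
  \<open>Suc a\<close>.\<close>

lemma ends_iff: "t \<noteq> Lf \<Longrightarrow> (a, a + size t - 1) \<in> conn (pair_edges a t) \<longleftrightarrow> ends t"
proof (induction t arbitrary: a)
  case (Nd b l r)
  let ?m = "Suc a + size l"
  interpret gluing a ?m "a + size (Nd b l r)" "pair_edges (Suc a) l" "pair_edges ?m r"
    "r \<noteq> Lf" "root_bond l" "root_bond r"
    by (rule gluing_pair) auto
  show ?case
  proof (cases "r = Lf")
    case False
    then have "size r > 0" using size_eq_0_iff[of r] by (simp del: size_eq_0_iff)
    then show ?thesis
      using conn_glue_right[of a "?m + size r - 1"] Nd.IH(2)[OF False, of ?m] False
      by (simp add: add.assoc)
  next
    case r: True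
    show ?thesis
    proof (cases "l = Lf")
      case False
      then have "size l > 0" using size_eq_0_iff[of l] by (simp del: size_eq_0_iff)
      then show ?thesis
        using conn_glue_root_left[of "a + size l"] Nd.IH(1)[OF False, of "Suc a"] False r by simp
    qed (simp add: r)
  qed
qed simp

text \<open>The distance in the Hasse diagram of the two partitions encoded by a tree.\<close>

fun weight :: "ct \<Rightarrow> int" where
  "weight Lf = 0"
| "weight (Nd b l r) = weight l + weight r +
    (if l = Lf then of_bool (r \<noteq> Lf \<and> \<not> root_bond r)
     else if r = Lf then of_bool (root_bond l)
     else if root_bond l \<and> root_bond r then (if ends l then 1 else 3)
     else if root_bond l \<or> root_bond r then 2 else 1)"

text \<open>An edge that merges two components both in its own partition and in the join contributes
  -1 + 2 = 1; one that is redundant in the join contributes -1. So three edges give 3, or 1 + 1 - 1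
  = 1 if they close the cycle. For \<open>l = Lf\<close> a bond at the root of \<open>r\<close>
  repeats the edge \<open>(a, m)\<close> and cancels its 1.\<close>

lemma weight_eq:
  "int (card (comps {a..<a + size t} (int_edges a t))) + int (card (comps {a..<a + size t} (nc_edges a t)))
    - 2 * int (card (comps {a..<a + size t} (pair_edges a t))) = weight t"
proof (induction t arbitrary: a)
  case Lf
  then show ?case by (simp add: comps_def)
next
  case (Nd b l r)
  let ?m = "Suc a + size l" and ?k = "a + size (Nd b l r)"
  note IH = Nd.IH(1)[of "Suc a"] Nd.IH(2)[of ?m]
  have k: "?k = ?m + size r" by simp
  have i: "gluing a ?m ?k (int_edges (Suc a) l) (int_edges ?m r) False (root_bond l) (root_bond r)"
    by (rule gluing_int) auto
  have n: "gluing a ?m ?k (nc_edges (Suc a) l) (nc_edges ?m r) (r \<noteq> Lf) False False"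
    by (rule gluing_nc) auto
  have p: "gluing a ?m ?k (pair_edges (Suc a) l) (pair_edges ?m r) (r \<noteq> Lf) (root_bond l) (root_bond r)"
    by (rule gluing_pair) auto
  have e: "(Suc a, ?m - 1) \<in> conn (pair_edges (Suc a) l) \<longleftrightarrow> ends l" if "l \<noteq> Lf"
    using ends_iff[OF that, of "Suc a"] by simp
  show ?case
    unfolding int_edges_Nd nc_edges.simps pair_edges_Nd
      gluing.card_glue[OF i] gluing.card_glue[OF n] gluing.card_glue[OF p]
    using IH e unfolding k
    by (cases "l = Lf"; cases "r = Lf"; cases "root_bond l"; cases "root_bond r"; cases "ends l") auto
qed

section \<open>Trees correspond bijectively to pairs of partitions\<close>

lemma conn_nc_edges_right:
  assumes "Suc a + size l \<le> x" "Suc a + size l \<le> y"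
  shows "(x, y) \<in> conn (nc_edges a (Nd b l r)) \<longleftrightarrow> (x, y) \<in> conn (nc_edges (Suc a + size l) r)"
  unfolding nc_edges.simps
  using gluing.conn_glue_right[OF gluing_nc[of "r \<noteq> Lf" r False l False a], of x y] assms by auto

lemma conn_nc_edges_left:
  assumes "Suc a \<le> x" "x < Suc a + size l"
  shows "(x, y) \<in> conn (nc_edges a (Nd b l r)) \<longleftrightarrow> (x, y) \<in> conn (nc_edges (Suc a) l)"
proof (cases "Suc a \<le> y \<and> y < Suc a + size l")
  case True
  then show ?thesis unfolding nc_edges.simps
    using gluing.conn_glue_left[OF gluing_nc[of "r \<noteq> Lf" r False l False a], of x y] assms by auto
next
  case False
  have "(x, y) \<notin> conn (nc_edges (Suc a) l)"
    using conn_field[OF _ nc_edges_subset[of "Suc a" l], of x y] False assms by auto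
  moreover have "(x, y) \<notin> conn (nc_edges a (Nd b l r))"
    unfolding nc_edges.simps
    using gluing.conn_glue_cross[OF gluing_nc[of "r \<noteq> Lf" r False l False a], of x y] assms False by auto
  ultimately show ?thesis by simp
qed

lemma conn_nc_edges_root:
  assumes "y \<noteq> a"
  shows "(a, y) \<in> conn (nc_edges a (Nd b l r)) \<longleftrightarrow>
    r \<noteq> Lf \<and> Suc a + size l \<le> y \<and> (Suc a + size l, y) \<in> conn (nc_edges (Suc a + size l) r)"
proof -
  interpret gluing a "Suc a + size l" "a + size (Nd b l r)" "nc_edges (Suc a) l" "nc_edges (Suc a + size l) r"
    "r \<noteq> Lf" False False
    by (rule gluing_nc) auto
  show ?thesis
  proof (cases "r = Lf")
    case True
    then show ?thesis using conn_glue_root[of y] assms by auto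
  next
    case False
    have "Suc a + size l \<le> y" if "(a, y) \<in> conn G"
    proof (rule ccontr)
      assume "\<not> ?thesis"
      moreover have "a \<le> y" using conn_field[OF that glue_subset] by auto
      ultimately have "Suc a \<le> y" "y < Suc a + size l" using assms by auto
      then show False using conn_glue_cross[of y a] conn_sym[OF that] by auto
    qed
    then show ?thesis using conn_glue_right[of a y] False by auto
  qed
qed

lemma nonx_nc_edges: "nonx (nc_edges a t)"
proof (induction t arbitrary: a)
  case Lf
  then show ?case by (simp add: nonx_def)
next
  case (Nd b l r)
  let ?m = "Suc a + size l" and ?t = "Nd b l r"
  let ?C = "conn (nc_edges a ?t)"
  show ?case
    unfolding nonx_def
  proof (intro allI impI)
    fix x1 x2 x3 x4
    assume "x1 < x2 \<and> x2 < x3 \<and> x3 < x4 \<and> (x1, x3) \<in> ?C \<and> (x2, x4) \<in> ?C"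
    then have lt: "x1 < x2" "x2 < x3" "x3 < x4" and C: "(x1, x3) \<in> ?C" "(x2, x4) \<in> ?C" by auto
    have ge: "a \<le> x1" using conn_field[OF C(1) nc_edges_subset] lt by auto
    show "(x1, x2) \<in> ?C"
    proof (cases "x1 = a")
      \<comment> \<open>A crossing that starts in \<open>a\<close> is moved into the right part by
        replacing \<open>a\<close> with \<open>?m\<close>.\<close>
      case True
      then have r: "r \<noteq> Lf" "?m \<le> x3" "(?m, x3) \<in> conn (nc_edges ?m r)"
        using C(1) lt conn_nc_edges_root[of x3 a b l r] by auto
      have x2: "?m \<le> x2"
      proof (rule ccontr)
        assume "\<not> ?m \<le> x2"
        then have "(x2, x4) \<in> conn (nc_edges (Suc a) l)"
          using C(2) lt True conn_nc_edges_left[of a x2 l x4 b r] by auto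
        then show False using conn_field[OF _ nc_edges_subset] lt r(2) by fastforce
      qed
      then have "(x2, x4) \<in> conn (nc_edges ?m r)"
        using C(2) lt conn_nc_edges_right[of a l x2 x4 b r] by auto
      then have "(?m, x2) \<in> conn (nc_edges ?m r)"
        using nonxD[OF Nd.IH(2)[of ?m], of ?m x2 x3 x4] r(3) x2 lt by (cases "?m = x2") auto
      then show ?thesis
        using conn_nc_edges_root[of x2 a b l r] True r lt x2 by auto
    next
      case False
      show ?thesis
      proof (cases "x1 < ?m")
        case True
        then have 1: "(x1, x3) \<in> conn (nc_edges (Suc a) l)"
          using C(1) False ge conn_nc_edges_left[of a x1 l x3 b r] by auto
        then have "x3 < ?m" using conn_field[OF _ nc_edges_subset] lt by fastforce
        then have "(x2, x4) \<in> conn (nc_edges (Suc a) l)"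
          using C(2) False ge lt conn_nc_edges_left[of a x2 l x4 b r] by auto
        then have "(x1, x2) \<in> conn (nc_edges (Suc a) l)"
          using 1 Nd.IH(1)[of "Suc a"] lt unfolding nonx_def by blast
        then show ?thesis using conn_nc_edges_left[of a x1 l x2 b r] True False ge by auto
      next
        case False
        then have "(x1, x3) \<in> conn (nc_edges ?m r)" "(x2, x4) \<in> conn (nc_edges ?m r)"
          using C lt conn_nc_edges_right[of a l x1 x3 b r] conn_nc_edges_right[of a l x2 x4 b r] by auto
        then have "(x1, x2) \<in> conn (nc_edges ?m r)"
          using Nd.IH(2)[of ?m] lt unfolding nonx_def by blast
        then show ?thesis using conn_nc_edges_right[of a l x1 x2 b r] False lt by auto
      qed
    qed
  qed
qed

text \<open>The relation determines where the tree splits, because \<open>Suc a + size l\<close> is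
  the least element above \<open>a\<close> in the block of \<open>a\<close>, or the end of the range
  if there is none. The relations and flags of the subtrees are then restrictions.\<close>

lemma tree_inj:
  assumes "size t = size t'" "conn (nc_edges a t) = conn (nc_edges a t')" "bonded a t = bonded a t'"
  shows "t = t'"
  using assms
proof (induction t arbitrary: a t')
  case Lf
  then show ?case by (metis size_eq_0_iff ct.size(3))
next
  case (Nd b l r)
  from Nd.prems(1) obtain b' l' r' where t': "t' = Nd b' l' r'" by (cases t') auto
  have sz: "size l + size r = size l' + size r'" using Nd.prems(1) t' by simp
  have le: "size l \<le> size l'" if "size l + size r = size l' + size r'"
    "conn (nc_edges a (Nd b l r)) = conn (nc_edges a (Nd b' l' r'))" for b l r b' l' r'
  proof (rule ccontr)
    assume lt: "\<not> size l \<le> size l'"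
    then have "r' \<noteq> Lf" using that(1) by auto
    then have "(a, Suc a + size l') \<in> conn (nc_edges a (Nd b' l' r'))"
      using conn_nc_edges_root[of "Suc a + size l'" a b' l' r'] by simp
    then have "(a, Suc a + size l') \<in> conn (nc_edges a (Nd b l r))" using that(2) by simp
    then show False using conn_nc_edges_root[of "Suc a + size l'" a b l r] lt by simp
  qed
  have C: "conn (nc_edges a (Nd b l r)) = conn (nc_edges a (Nd b' l' r'))" using Nd.prems(2) t' by simp
  have sl: "size l = size l'" using le[OF sz C] le[OF sz[symmetric] C[symmetric]] by simp
  let ?m = "Suc a + size l"
  have "(x, y) \<in> conn (nc_edges (Suc a) l) \<longleftrightarrow> (x, y) \<in> conn (nc_edges (Suc a) l')" for x y
  proof (cases "Suc a \<le> x \<and> x < ?m")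
    case True
    then show ?thesis
      using conn_nc_edges_left[of a x l y b r] conn_nc_edges_left[of a x l' y b' r'] C sl by simp
  next
    case False
    then show ?thesis
      using conn_field[OF _ nc_edges_subset[of "Suc a" l], of x y]
        conn_field[OF _ nc_edges_subset[of "Suc a" l'], of x y] sl by auto
  qed
  then have Cl: "conn (nc_edges (Suc a) l) = conn (nc_edges (Suc a) l')" by auto
  have "(x, y) \<in> conn (nc_edges ?m r) \<longleftrightarrow> (x, y) \<in> conn (nc_edges ?m r')" for x y
  proof (cases "?m \<le> x \<and> ?m \<le> y")
    case True
    then show ?thesis
      using conn_nc_edges_right[of a l x y b r] conn_nc_edges_right[of a l' x y b' r'] C sl by simp
  next
    case False
    then show ?thesis
      using conn_field[OF _ nc_edges_subset[of ?m r], of x y]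
        conn_field[OF _ nc_edges_subset[of ?m r'], of x y] sl by auto
  qed
  then have Cr: "conn (nc_edges ?m r) = conn (nc_edges ?m r')" by auto
  have bl: "bonded (Suc a) l = bonded a (Nd b l r) \<inter> {Suc a..<Suc a + size l}" for b l r
    using bonded_subset[of "Suc a" l] bonded_subset[of "Suc a + size l" r] by (auto simp: opt_def)
  have br: "bonded (Suc a + size l) r = bonded a (Nd b l r) \<inter> {Suc a + size l..}" for b l r
    using bonded_subset[of "Suc a" l] bonded_subset[of "Suc a + size l" r] by (auto simp: opt_def)
  have B: "bonded a (Nd b l r) = bonded a (Nd b' l' r')" using Nd.prems(3) t' by simp
  have "b = b'" using B by (metis bonded_root root_bond.simps(2))
  moreover have "l = l'" by (rule Nd.IH(1)[OF sl Cl]) (simp only: bl[of l b r] bl[of l' b' r'] B sl)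
  moreover have "r = r'"
    by (rule Nd.IH(2)[OF _ Cr]) (use sl sz br[of l r b] br[of l' r' b'] B in auto)
  ultimately show ?case using t' by simp
qed

lemma tree_surj:
  assumes "E \<subseteq> {a..<a + n} \<times> {a..<a + n}" "nonx E" "B \<subseteq> {a..<a + n}"
  shows "\<exists>t. size t = n \<and> conn (nc_edges a t) = conn E \<and> bonded a t = B"
  using assms
proof (induction n arbitrary: a E B rule: less_induct)
  case (less n)
  show ?case
  proof (cases n)
    case 0
    then show ?thesis using less.prems by (intro exI[of _ Lf]) auto
  next
    case (Suc n')
    define p where "p \<longleftrightarrow> (\<exists>z. a < z \<and> (a, z) \<in> conn E)"
    \<comment> \<open>If \<open>a\<close> is alone in its block, \<open>m\<close> is placed just
      past the end, which leaves the right part empty.\<close>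
    define m where "m = (if p then LEAST z. a < z \<and> (a, z) \<in> conn E else a + n)"
    have in_V: "x \<in> {a..<a + n} \<and> y \<in> {a..<a + n}" if "(x, y) \<in> conn E" "x \<noteq> y" for x y
      using conn_field[OF that(1) less.prems(1)] that(2) by auto
    have pm: "a < m \<and> (a, m) \<in> conn E" if p
      using that unfolding m_def p_def by simp (rule LeastI_ex)
    have min: "m \<le> z" if "a < z" "(a, z) \<in> conn E" for z
      using that unfolding m_def p_def by (auto intro: Least_le)
    have am: "a < m" using pm Suc by (cases p) (auto simp: m_def)
    have p_iff: "p \<longleftrightarrow> m < a + n"
      using pm in_V[of a m] by (cases p) (auto simp: m_def)
    have mk: "m \<le> a + n" using p_iff by (cases p) (auto simp: m_def)
    define El where "El = conn E \<inter> {Suc a..<m} \<times> {Suc a..<m}"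
    \<comment> \<open>The closure is restricted rather than \<open>E\<close>, since elements of the
      right part may be connected in \<open>E\<close> only by way of \<open>a\<close>.\<close>
    define Er where "Er = conn E \<inter> {m..<a + n} \<times> {m..<a + n}"
    have restr: "nonx (conn E \<inter> W \<times> W)" for W
      unfolding nonx_def
    proof (intro allI impI)
      let ?R = "conn E \<inter> W \<times> W"
      fix x1 x2 x3 x4
      assume H: "x1 < x2 \<and> x2 < x3 \<and> x3 < x4 \<and> (x1, x3) \<in> conn ?R \<and> (x2, x4) \<in> conn ?R"
      have "conn ?R \<subseteq> conn E" by (rule conn_least) blast
      then have "(x1, x2) \<in> conn E" using H less.prems(2) unfolding nonx_def by blast
      moreover have "x1 \<in> W" "x2 \<in> W"
        using conn_field[of x1 x3 ?R W] conn_field[of x2 x4 ?R W] H by auto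
      ultimately show "(x1, x2) \<in> conn ?R" by (intro conn_edge) auto
    qed
    define i where "i = m - Suc a"
    define j where "j = a + n - m"
    have i: "Suc a + i = m" "i < n" and j: "m + j = a + n" "j < n"
      using am mk Suc by (auto simp: i_def j_def)
    obtain l where l: "size l = i" "conn (nc_edges (Suc a) l) = conn El" "bonded (Suc a) l = B \<inter> {Suc a..<m}"
      using less.IH[OF i(2), of El "Suc a" "B \<inter> {Suc a..<m}"] restr[of "{Suc a..<m}"] i
      by (auto simp: El_def)
    obtain r where r: "size r = j" "conn (nc_edges m r) = conn Er" "bonded m r = B \<inter> {m..<a + n}"
      using less.IH[OF j(2), of Er m "B \<inter> {m..<a + n}"] restr[of "{m..<a + n}"] j
      by (auto simp: Er_def)
    have rp: "r \<noteq> Lf \<longleftrightarrow> p" using r(1) j p_iff size_eq_0_iff[of r] by linarith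
    let ?t = "Nd (a \<in> B) l r"
    have "nc_edges a ?t = glue a m (nc_edges (Suc a) l) (nc_edges m r) p False False"
      using l(1) i(1) rp by simp
    then have C: "conn (nc_edges a ?t) = conn (glue a m El Er p False False)"
      using conn_glue_cong[OF l(2) r(2)] by simp
    let ?G = "glue a m El Er p False False"
    have "conn ?G = conn E"
    proof
      show "conn ?G \<subseteq> conn E"
        by (rule conn_least) (use pm in \<open>auto simp: glue_def El_def Er_def\<close>)
      have G: "El \<subseteq> conn ?G" "Er \<subseteq> conn ?G" "p \<Longrightarrow> (a, m) \<in> conn ?G"
        by (auto simp: glue_def intro!: conn_edge)
      have lt: "(x, y) \<in> conn ?G" if "x < y" "(x, y) \<in> conn E" for x y
      proof -
        have V: "a \<le> x" "y < a + n" using in_V[of x y] that by auto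
        consider "x = a" | "a < x" "y < m" | "a < x" "x < m" "m \<le> y" | "m \<le> x"
          using V that(1) by linarith
        then show ?thesis
        proof cases
          case 1
          then have my: "m \<le> y" using min that by auto
          then have p using p_iff V by simp
          then have "(m, y) \<in> conn E" using pm that 1 by (meson conn_sym conn_trans)
          then have "(m, y) \<in> Er" using my V by (auto simp: Er_def)
          then have "(m, y) \<in> conn ?G" using G(2) by blast
          then show ?thesis using conn_trans[OF G(3)[OF \<open>p\<close>]] 1 by simp
        next
          case 2
          then have "(x, y) \<in> El" using that by (auto simp: El_def)
          then show ?thesis using G by blast
        next
          case 3
          then have p using p_iff V by simp
          \<comment> \<open>A pair leading from the left part to the right part ends in
            \<open>m\<close> or crosses \<open>(a, m)\<close>. Either way \<open>x\<close> lies in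
            the block of \<open>a\<close>, against the minimality of \<open>m\<close>.\<close>
          have "(a, x) \<in> conn E"
          proof (cases "y = m")
            case True
            then show ?thesis using pm[OF \<open>p\<close>] that by (meson conn_sym conn_trans)
          next
            case False
            then show ?thesis
              using nonxD[OF less.prems(2), of a x m y] 3 pm[OF \<open>p\<close>] that by simp
          qed
          then show ?thesis using min[of x] 3 by simp
        next
          case 4
          then have "(x, y) \<in> Er" using that V by (auto simp: Er_def)
          then show ?thesis using G by blast
        qed
      qed
      have "(x, y) \<in> conn ?G" if "(x, y) \<in> conn E" for x y
        using lt[of x y] lt[of y x] that conn_sym[of x y E] conn_sym[of y x ?G]
        by (cases x y rule: linorder_cases) auto
      then show "conn E \<subseteq> conn ?G" by auto
    qed
    moreover have "bonded a ?t = B"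
    proof -
      have "{a..<a + n} = {a} \<union> {Suc a..<m} \<union> {m..<a + n}" using am mk by auto
      then have "opt (a \<in> B) a \<union> B \<inter> {Suc a..<m} \<union> B \<inter> {m..<a + n} = B"
        using less.prems(3) by (auto simp: opt_def)
      then show ?thesis using l(1,3) r(3) i(1) by simp
    qed
    moreover have "size ?t = n" using l r i j by simp
    ultimately show ?thesis using C by blast
  qed
qed

definition trees :: "nat \<Rightarrow> ct set" where
  "trees n = {t. size t = n}"

definition root_trees :: "nat \<Rightarrow> ct set" where
  "root_trees n = {t. size t = n \<and> \<not> root_bond t}"

lemma tree_bij:
  "bij_betw (\<lambda>t. (bonded 1 t, comps {1..n} (nc_edges 1 t))) (root_trees n) (Pow {2..n} \<times> NC n)"
proof (rule bij_betwI')
  have V: "{1..<1 + n} = {1..n}" by auto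
  have sub: "nc_edges 1 t \<subseteq> {1..n} \<times> {1..n}" if "size t = n" for t
    using nc_edges_subset[of 1 t] that V by auto
  show "((bonded 1 t, comps {1..n} (nc_edges 1 t)) = (bonded 1 t', comps {1..n} (nc_edges 1 t'))) = (t = t')"
    if "t \<in> root_trees n" "t' \<in> root_trees n" for t t'
  proof
    assume "(bonded 1 t, comps {1..n} (nc_edges 1 t)) = (bonded 1 t', comps {1..n} (nc_edges 1 t'))"
    moreover from this have "conn (nc_edges 1 t) = conn (nc_edges 1 t')"
      using conn_same_block_comps[OF sub] that unfolding root_trees_def by (metis (mono_tags, lifting) mem_Collect_eq prod.inject)
    ultimately show "t = t'"
      using that by (intro tree_inj[of t t' 1]) (auto simp: root_trees_def)
  qed simp
  show "(bonded 1 t, comps {1..n} (nc_edges 1 t)) \<in> Pow {2..n} \<times> NC n" if "t \<in> root_trees n" for t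
  proof -
    have t: "size t = n" "\<not> root_bond t" using that by (auto simp: root_trees_def)
    have "bonded 1 t \<subseteq> {1..<1 + n} - {1}" using bonded_subset[of 1 t] bonded_root[of 1 t] t by auto
    then have "bonded 1 t \<subseteq> {2..n}" by auto
    moreover have "comps {1..n} (nc_edges 1 t) \<in> NC n" by (rule comps_in_NC[OF sub[OF t(1)] nonx_nc_edges])
    ultimately show ?thesis by simp
  qed
  show "\<exists>t\<in>root_trees n. y = (bonded 1 t, comps {1..n} (nc_edges 1 t))" if "y \<in> Pow {2..n} \<times> NC n" for y
  proof -
    obtain B Q where y: "y = (B, Q)" "B \<subseteq> {2..n}" "Q \<in> NC n" using \<open>y \<in> _\<close> by auto
    have "same_block Q \<subseteq> {1..<1 + n} \<times> {1..<1 + n}" using NC_D(3)[OF y(3)] V by simp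
    moreover have "B \<subseteq> {1..<1 + n}" using y(2) by auto
    ultimately obtain t where t: "size t = n" "conn (nc_edges 1 t) = conn (same_block Q)" "bonded 1 t = B"
      using tree_surj[of "same_block Q" 1 n B] NC_D(2)[OF y(3)] by blast
    have "\<not> root_bond t" using bonded_root[of 1 t] t(3) y(2) by auto
    moreover have "comps {1..n} (nc_edges 1 t) = Q" using comps_cong[OF t(2)] NC_D(4)[OF y(3)] by simp
    ultimately show ?thesis using t y(1) by (intro bexI[of _ t]) (auto simp: root_trees_def)
  qed
qed

section \<open>Generating functions\<close>

unbundle fps_syntax

lemma catalan_recurrence: "(real n + 2) * catalan (Suc n) = (4 * real n + 2) * catalan n"
proof -
  have "fact (2 * Suc n) = (2 * real n + 2) * (2 * real n + 1) * fact (2 * n)"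
    by (simp add: algebra_simps)
  moreover have "fact (Suc n + 1) = (real n + 2) * (fact (n + 1) :: real)"
    "fact (Suc n) = (real n + 1) * (fact n :: real)"
    by (simp_all add: algebra_simps)
  ultimately have "catalan (Suc n) =
      ((2 * real n + 2) * (2 * real n + 1)  * fact (2 * n)) / ((real n + 1) * fact n * ((real n + 2) * fact (n + 1)))"
    unfolding catalan_def by (simp only: mult_ac)
  also have "\<dots> = 2 * (2 * real n + 1) / (real n + 2) * catalan n"
  proof -
    have "real n + 1 \<noteq> 0" "real n + 2 \<noteq> 0" by linarith+
    then show ?thesis unfolding catalan_def by (simp add: divide_simps) (simp add: algebra_simps)
  qed
  finally show ?thesis by (simp add: field_simps)
qed

lemma catalan_recurrence_scaled:
  "(real n + 2) * (2 ^ Suc n * catalan (Suc n)) = (8 * real n + 4) * (2 ^ n * catalan n)"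
proof -
  have "(real n + 2) * (2 ^ Suc n * catalan (Suc n)) = 2 ^ Suc n * ((4 * real n + 2) * catalan n)"
    unfolding catalan_recurrence[symmetric] by (simp only: mult_ac)
  also have "\<dots> = (8 * real n + 4) * (2 ^ n * catalan n)"
    by (simp add: algebra_simps)
  finally show ?thesis .
qed

text \<open>In the coefficient of \<open>x\<^sup>n\<close>, \<open>g\<close> counts the trees with \<open>n\<close> nodes, \<open>s\<close> those whose first
  and last elements lie in the same block of the join, and \<open>w\<close> is the sum of all distances.\<close>

locale tree_series =
  fixes g s w :: "real fps"
  assumes g: "g = 1 + 2 * fps_X * g\<^sup>2"
    and s: "s = 2 * fps_X + fps_X * s + 2 * fps_X * g * s"
    and w: "w = 4 * fps_X * w * g + 4 * fps_X * (g - 1)\<^sup>2 + 2 * fps_X * (g - 1) - fps_X * s * (g - 1)"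
begin

text \<open>\<open>1 - 4 * fps_X * g\<close> is a square root of the discriminant of the quadratic
  equation for \<open>g\<close>.\<close>

lemma g_disc: "(1 - 4 * fps_X * g)\<^sup>2 = 1 - 8 * fps_X"
  using g by algebra

lemma g_deriv: "(1 - 4 * fps_X * g) * fps_deriv g = 2 * g\<^sup>2"
proof -
  have "fps_deriv g = fps_deriv (1 + 2 * fps_X * g\<^sup>2)" using g by simp
  also have "\<dots> = 2 * g\<^sup>2 + 4 * fps_X * g * fps_deriv g"
    by (simp add: power2_eq_square algebra_simps)
  finally show ?thesis by (simp add: algebra_simps)
qed

text \<open>A second factor \<open>1 - 4 * fps_X * g\<close> removes the square root from
  \<open>g_deriv\<close>. What remains is linear in \<open>g\<close> and its derivative, so
  comparing coefficients yields the two-term recurrence of the scaled Catalan numbers.\<close>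

lemma g_ode: "fps_X * (1 - 8 * fps_X) * fps_deriv g = 1 - g + 4 * fps_X * g"
proof -
  have "fps_X * (1 - 8 * fps_X) * fps_deriv g = fps_X * (1 - 4 * fps_X * g) * ((1 - 4 * fps_X * g) * fps_deriv g)"
    using g_disc by algebra
  then show ?thesis using g unfolding g_deriv by algebra
qed

lemma g_nth: "g $ n = 2 ^ n * catalan n"
proof (induction n)
  case 0
  have "g $ 0 = (1 + 2 * fps_X * g\<^sup>2) $ 0" using g by simp
  then show ?case by (simp add: catalan_def mult.assoc numeral_fps_const)
next
  case (Suc n)
  have "fps_X * (fps_deriv g - fps_const 8 * (fps_X * fps_deriv g)) = 1 - g + fps_const 4 * (fps_X * g)"
    using g_ode by (simp add: numeral_fps_const algebra_simps)
  then have "(fps_X * (fps_deriv g - fps_const 8 * (fps_X * fps_deriv g))) $ Suc n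
      = (1 - g + fps_const 4 * (fps_X * g)) $ Suc n" by simp
  then have "(real n + 1) * g $ Suc n - 8 * (real n * g $ n) = - g $ Suc n + 4 * g $ n"
    by (cases n) (simp_all add: algebra_simps)
  then have "(real n + 2) * g $ Suc n = (8 * real n + 4) * g $ n"
    by (simp add: algebra_simps)
  also have "\<dots> = (real n + 2) * (2 ^ Suc n * catalan (Suc n))"
    unfolding Suc.IH catalan_recurrence_scaled ..
  finally have "(real n + 2) * g $ Suc n = (real n + 2) * (2 ^ Suc n * catalan (Suc n))" .
  then show ?case by (simp add: mult_cancel_left)
qed

text \<open>Rationalising the denominator: exchanging the two roots of the equation for
  \<open>g\<close> takes \<open>1 - x - 2 x g\<close> to \<open>x (2 g - 1)\<close>, and the product
  of the two is \<open>x (1 + x)\<close>.\<close>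

lemma s_eq: "s * (1 + fps_X) = 2 * fps_X * (2 * g - 1)"
proof -
  have "1 + fps_X = (1 - fps_X - 2 * fps_X * g) * (2 * g - 1)" using g by algebra
  moreover have "s * (1 - fps_X - 2 * fps_X * g) = 2 * fps_X" using s by algebra
  ultimately show ?thesis by algebra
qed

lemma w_eq: "3 * w = 2 * fps_X * fps_deriv g - 4 * (g - 1) + 2 * s"
proof -
  let ?r = "1 - 4 * fps_X * g"
  \<comment> \<open>The factor \<open>5 x g + 3 x - 2\<close> is what multiplies \<open>s\<close>
    when the two sides of the claim, each multiplied by \<open>?r\<close>, are subtracted.\<close>
  have ss: "s * (5 * fps_X * g + 3 * fps_X - 2) = 2 * fps_X * (g - 3)"
  proof -
    have "5 * fps_X * g + 3 * fps_X - 2 = (g - 3) * (1 - fps_X - 2 * fps_X * g)" using g by algebra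
    moreover have "s * (1 - fps_X - 2 * fps_X * g) = 2 * fps_X" using s by algebra
    ultimately show ?thesis by algebra
  qed
  have "?r * (3 * w) = 3 * fps_X * (4 * (g - 1)\<^sup>2 + 2 * (g - 1) - s * (g - 1))"
    using w by algebra
  also have "\<dots> = 2 * fps_X * (2 * g\<^sup>2) + ?r * (2 * s - 4 * (g - 1))"
    using ss g by algebra
  also have "\<dots> = 2 * fps_X * (?r * fps_deriv g) + ?r * (2 * s - 4 * (g - 1))"
    by (simp only: g_deriv)
  also have "\<dots> = ?r * (2 * fps_X * fps_deriv g - 4 * (g - 1) + 2 * s)"
    by algebra
  finally have "?r * (3 * w) = ?r * (2 * fps_X * fps_deriv g - 4 * (g - 1) + 2 * s)" .
  moreover have "?r \<noteq> 0"
  proof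
    assume "?r = 0"
    then have "(1 - 4 * fps_X * g) $ 0 = 0" by (metis fps_zero_nth)
    then show False by (simp add: mult.assoc numeral_fps_const)
  qed
  ultimately show ?thesis by (metis mult_left_cancel)
qed

lemma s_nth:
  assumes "n > 0"
  shows "s $ Suc n + s $ n = 4 * g $ n"
proof -
  have "s + fps_X * s = fps_const 4 * (fps_X * g) - fps_const 2 * fps_X"
    using s_eq by (simp add: numeral_fps_const algebra_simps)
  then have "(s + fps_X * s) $ Suc n = (fps_const 4 * (fps_X * g) - fps_const 2 * fps_X) $ Suc n" by simp
  then show ?thesis using assms by simp
qed

lemma w_nth:
  assumes "n > 0"
  shows "3 * w $ n = (2 * real n - 4) * g $ n + 2 * s $ n"
proof -
  have "fps_const 3 * w = fps_const 2 * (fps_X * fps_deriv g) - fps_const 4 * (g - 1) + fps_const 2 * s"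
    using w_eq by (simp add: numeral_fps_const algebra_simps)
  then have "(fps_const 3 * w) $ n = (fps_const 2 * (fps_X * fps_deriv g) - fps_const 4 * (g - 1) + fps_const 2 * s) $ n"
    by simp
  then show ?thesis using assms by (cases n) (simp_all add: algebra_simps)
qed

lemma g_pos: "g $ n > 0"
  unfolding g_nth by (simp add: catalan_def)

text \<open>With limiting ratio 8, a limit p has to satisfy 8 p + p = 4. Convergence holds because
  the ratios \<open>c n\<close> are at least 4 for positive \<open>n\<close>, so that the deviation
  \<open>e\<close> shrinks by a factor of 4 up to an error of order 1/n.\<close>

lemma s_over_g_tendsto: "(\<lambda>n. s $ n / g $ n) \<longlonglongrightarrow> 4 / 9"
proof -
  define e where "e n = s $ n / g $ n - 4 / 9" for n
  define c where "c n = g $ Suc n / g $ n" for n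
  have c_eq: "c n = (8 * real n + 4) / (real n + 2)" for n
  proof -
    have "(real n + 2) * g $ Suc n = (8 * real n + 4) * g $ n"
      unfolding g_nth by (rule catalan_recurrence_scaled)
    then show ?thesis using g_pos[of n] unfolding c_def by (simp add: field_simps)
  qed
  have c_ge: "c n \<ge> 4" if "n > 0" for n
    using that unfolding c_eq by (simp add: field_simps)
  have step: "e (Suc n) = (32 / 9 - 4 / 9 * c n - e n) / c n" if "n > 0" for n
  proof -
    have "s $ Suc n / g $ n + s $ n / g $ n = 4"
      using s_nth[OF that] g_pos[of n] by (simp add: field_simps)
    moreover have "s $ Suc n / g $ n = s $ Suc n / g $ Suc n * c n"
      using g_pos[of n] g_pos[of "Suc n"] unfolding c_def by simp
    ultimately have "(e (Suc n) + 4 / 9) * c n + (e n + 4 / 9) = 4" unfolding e_def by simp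
    then show ?thesis using c_ge[OF that] by (simp add: field_simps)
  qed
  have bound: "\<bar>e (Suc n)\<bar> \<le> \<bar>e n\<bar> / 4 + 2 / (real n + 2)" if "n > 0" for n
  proof -
    \<comment> \<open>From \<open>c n = 8 - 12 / (n + 2)\<close>.\<close>
    have "32 / 9 - 4 / 9 * c n = 16 / 3 / (real n + 2)" unfolding c_eq by (simp add: field_simps)
    then have "\<bar>e (Suc n)\<bar> = \<bar>16 / 3 / (real n + 2) - e n\<bar> / c n"
      using c_ge[OF that] unfolding step[OF that] by (simp add: abs_divide)
    also have "\<dots> \<le> (16 / 3 / (real n + 2) + \<bar>e n\<bar>) / 4"
    proof (rule frac_le)
      have "0 \<le> 16 / 3 / (real n + 2)" by simp
      then show "\<bar>16 / 3 / (real n + 2) - e n\<bar> \<le> 16 / 3 / (real n + 2) + \<bar>e n\<bar>"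
        "0 \<le> 16 / 3 / (real n + 2) + \<bar>e n\<bar>" by linarith+
    qed (use c_ge[OF that] in auto)
    also have "\<dots> \<le> \<bar>e n\<bar> / 4 + 2 / (real n + 2)" by (simp add: field_simps)
    finally show ?thesis .
  qed
  \<comment> \<open>The summand \<open>\<bar>e 1\<bar>\<close> settles the base case; the induction
    step uses that \<open>C\<close> is at least 2 to absorb the error term.\<close>
  define C where "C = \<bar>e 1\<bar> + 4"
  have "\<bar>e n\<bar> \<le> 2 * C / (real n + 1)" if "n > 0" for n
    using that
  proof (induction n rule: nat_induct_non_zero)
    case 1
    show ?case by (simp add: C_def)
  next
    case (Suc n)
    have "\<bar>e (Suc n)\<bar> \<le> (2 * C / (real n + 1)) / 4 + 2 / (real n + 2)"
      by (rule order.trans[OF bound[OF Suc.hyps] add_right_mono[OF divide_right_mono[OF Suc.IH]]]) simp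
    also have "\<dots> \<le> 2 * C / (real (Suc n) + 1)"
    proof -
      have "2 * C / (real n + 1) / 4 \<le> C / (real n + 2)"
        using Suc.hyps by (simp add: C_def divide_simps) (simp add: algebra_simps)
      moreover have "2 / (real n + 2) \<le> C / (real n + 2)"
        by (intro divide_right_mono) (auto simp: C_def)
      ultimately show ?thesis by (simp add: add.commute)
    qed
    finally show ?case .
  qed
  then have le: "\<forall>\<^sub>F n in sequentially. \<bar>e n\<bar> \<le> 2 * C / (real n + 1)"
    by (intro eventually_sequentiallyI[of 1]) auto
  have "(\<lambda>n. 2 * C / (real n + 1)) \<longlonglongrightarrow> 0"
    using tendsto_mult[OF tendsto_const[of "2 * C"] LIMSEQ_inverse_real_of_nat] by (simp add: divide_inverse add.commute)
  then have "(\<lambda>n. \<bar>e n\<bar>) \<longlonglongrightarrow> 0"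
    by (intro tendsto_sandwich[OF _ le tendsto_const]) auto
  then have "e \<longlonglongrightarrow> 0" by (rule tendsto_rabs_zero_cancel)
  then show ?thesis unfolding e_def by (simp only: LIM_zero_iff)
qed

end

section \<open>Interval partitions\<close>

lemma conn_bonds_iff:
  assumes "x \<le> y"
  shows "(x, y) \<in> conn (bonds B) \<longleftrightarrow> {x<..y} \<subseteq> B"
proof
  assume xy: "(x, y) \<in> conn (bonds B)"
  show "{x<..y} \<subseteq> B"
  proof (rule ccontr)
    assume "\<not> {x<..y} \<subseteq> B"
    then obtain i where "i \<in> {x<..y}" and "i \<notin> B" by blast
    then have i: "x < i" "i \<le> y" "i \<notin> B" by auto
    \<comment> \<open>A number \<open>i\<close> outside \<open>B\<close> is a cut: no pair of
      \<open>bonds B\<close> leads from below \<open>i\<close> to \<open>i\<close>.\<close>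
    have "(x < i, y < i) \<in> conn {}"
      using xy by (rule conn_hom[where h = "\<lambda>z. z < i"])
        (use i in \<open>auto simp: bonds_def less_Suc_eq dest: Suc_lessI\<close>)
    then show False using i by simp
  qed
next
  show "{x<..y} \<subseteq> B \<Longrightarrow> (x, y) \<in> conn (bonds B)"
    using assms
  proof (induction y)
    case (Suc y)
    show ?case
    proof (cases "x = Suc y")
      case False
      then have "x \<le> y" using Suc.prems by simp
      then have "{x<..Suc y} = insert (Suc y) {x<..y}" by auto
      then have "(x, y) \<in> conn (bonds B)" "(y, Suc y) \<in> conn (bonds B)"
        using Suc \<open>x \<le> y\<close> by (auto simp: bonds_def intro!: conn_edge)
      then show ?thesis by (rule conn_trans)
    qed simp
  qed simp
qed

lemma bonds_subset: "B \<subseteq> {2..n} \<Longrightarrow> bonds B \<subseteq> {1..n} \<times> {1..n}"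
  by (force simp: bonds_def)

lemma nonx_empty [simp]: "nonx {}"
  by (simp add: nonx_def)

lemma comps_bonds_in_NC:
  assumes "B \<subseteq> {2..n}"
  shows "comps {1..n} (bonds B) \<in> NC n"
proof (rule comps_in_NC[OF bonds_subset[OF assms]])
  have "finite B" using assms finite_subset by blast
  from nonx_bonds[OF this nonx_empty] show "nonx (bonds B)" by simp
qed

text \<open>\<open>B\<close> consists of the elements that are not the least of their block.\<close>

lemma interval_bij: "bij_betw (\<lambda>B. comps {1..n} (bonds B)) (Pow {2..n}) (interval_partitions n)"
proof (rule bij_betwI')
  fix B B' assume B: "B \<in> Pow {2..n}" "B' \<in> Pow {2..n}"
  have mem: "i \<in> B \<longleftrightarrow> i \<in> {2..n} \<and> (i - 1, i) \<in> conn (bonds B)" if "B \<in> Pow {2..n}" for B i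
  proof (cases i)
    case (Suc j)
    have "{j<..Suc j} = {Suc j}" by auto
    then show ?thesis using that conn_bonds_iff[of j "Suc j" B] Suc by auto
  qed (use that in auto)
  show "(comps {1..n} (bonds B) = comps {1..n} (bonds B')) = (B = B')"
  proof
    assume "comps {1..n} (bonds B) = comps {1..n} (bonds B')"
    then have "conn (bonds B) = conn (bonds B')"
      using conn_same_block_comps[OF bonds_subset] B by (metis PowD)
    then show "B = B'" using mem[OF B(1)] mem[OF B(2)] by blast
  qed simp
next
  fix B assume "B \<in> Pow {2..n}"
  then have B: "B \<subseteq> {2..n}" by simp
  have "\<exists>p\<in>{1..n}. \<exists>q\<in>{1..n}. p \<le> q \<and> V = {i. p \<le> i \<and> i \<le> q}" if V: "V \<in> comps {1..n} (bonds B)" for V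
  proof -
    obtain x where x: "x \<in> {1..n}" "V = conn (bonds B) `` {x}" using V by (auto simp: comps_def)
    have sub: "V \<subseteq> {1..n}"
    proof
      fix y assume "y \<in> V"
      then have "(x, y) \<in> conn (bonds B)" using x by simp
      from conn_field[OF this bonds_subset[OF B]] show "y \<in> {1..n}" using x by metis
    qed
    then have fin: "finite V" using finite_subset by blast
    have "x \<in> V" using x by simp
    define p q where "p = Min V" and "q = Max V"
    have pq': "p \<in> V" "q \<in> V" and bd: "\<And>z. z \<in> V \<Longrightarrow> p \<le> z \<and> z \<le> q"
      using Min_in[OF fin] Max_in[OF fin] Min_le[OF fin] Max_ge[OF fin] \<open>x \<in> V\<close>
      by (auto simp: p_def q_def)
    then have pq: "p \<in> V" "q \<in> V" "p \<le> q" by auto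
    have "(p, q) \<in> conn (bonds B)" using pq x by (auto intro: conn_trans conn_sym)
    then have pqB: "{p<..q} \<subseteq> B" using conn_bonds_iff pq by blast
    have "z \<in> V" if "p \<le> z" "z \<le> q" for z
    proof -
      have "(p, z) \<in> conn (bonds B)" using conn_bonds_iff[of p z B] pqB that by auto
      moreover have "(x, p) \<in> conn (bonds B)" using pq x by simp
      ultimately show ?thesis using x conn_trans[of x p "bonds B" z] by simp
    qed
    then have "V = {i. p \<le> i \<and> i \<le> q}" using bd by auto
    then show ?thesis using pq sub by (intro bexI[of _ p] bexI[of _ q]) auto
  qed
  then show "comps {1..n} (bonds B) \<in> interval_partitions n"
    using comps_bonds_in_NC[OF B] by (simp add: interval_partitions_def)
next
  fix P assume P: "P \<in> interval_partitions n"
  then have NC: "P \<in> NC n"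
    and int: "\<And>V. V \<in> P \<Longrightarrow> \<exists>p\<in>{1..n}. \<exists>q\<in>{1..n}. p \<le> q \<and> V = {i. p \<le> i \<and> i \<le> q}"
    by (auto simp: interval_partitions_def)
  let ?S = "same_block P"
  define B where "B = {i \<in> {2..n}. (i - 1, i) \<in> ?S}"
  have "conn (bonds B) = conn ?S"
  proof
    show "conn (bonds B) \<subseteq> conn ?S"
      by (rule conn_least) (auto simp: bonds_def B_def intro: conn_edge)
    have lt: "(x, y) \<in> conn (bonds B)" if xy: "x \<le> y" "(x, y) \<in> ?S" for x y
    proof -
      obtain V where V: "V \<in> P" "x \<in> V" "y \<in> V" using xy(2) by (auto simp: same_block_iff)
      obtain p q where pq: "p \<in> {1..n}" "q \<in> {1..n}" "V = {i. p \<le> i \<and> i \<le> q}" using int[OF V(1)] by blast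
      have "i \<in> B" if "x < i" "i \<le> y" for i
      proof -
        have "i - 1 \<in> V" "i \<in> V" using that V(2,3) unfolding pq(3) by auto
        then have "(i - 1, i) \<in> ?S" using V(1) by (auto simp: same_block_iff)
        moreover have "i \<in> {2..n}" using that V pq by auto
        ultimately show ?thesis by (simp add: B_def)
      qed
      then show ?thesis using conn_bonds_iff[OF xy(1)] by auto
    qed
    have "(x, y) \<in> conn (bonds B)" if "(x, y) \<in> ?S" for x y
    proof (cases "x \<le> y")
      case False
      have "(y, x) \<in> ?S" using that by (auto simp: same_block_iff)
      then show ?thesis using lt[of y x] False conn_sym by simp
    qed (use lt that in simp)
    then have "?S \<subseteq> conn (bonds B)" by auto
    then show "conn ?S \<subseteq> conn (bonds B)" by (rule conn_least)
  qed
  then have "comps {1..n} (bonds B) = P" using comps_cong NC_D(4)[OF NC] by metis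
  then show "\<exists>B\<in>Pow {2..n}. P = comps {1..n} (bonds B)"
    by (intro bexI[of _ B]) (auto simp: B_def)
qed

text \<open>The join is generated by the bonds together with \<open>nc_edges\<close>, so
  \<open>nonx_bonds\<close> shows that it is non-crossing, as \<open>hasse_dist_eq_join\<close>
  requires.\<close>

lemma hasse_dist_tree:
  assumes "t \<in> root_trees n"
  shows "hasse_dist n (comps {1..n} (bonds (bonded 1 t))) (comps {1..n} (nc_edges 1 t)) = of_int (weight t)"
proof -
  have t: "size t = n" "\<not> root_bond t" using assms by (auto simp: root_trees_def)
  have V: "{1..<1 + size t} = {1..n}" using t by auto
  have ie: "int_edges 1 t = bonds (bonded 1 t)" using bonded_root[of 1 t] t by (simp add: int_edges_def)
  let ?P = "comps {1..n} (int_edges 1 t)" and ?Q = "comps {1..n} (nc_edges 1 t)"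
  let ?J = "comps {1..n} (pair_edges 1 t)"
  have sub: "int_edges 1 t \<subseteq> {1..n} \<times> {1..n}" "nc_edges 1 t \<subseteq> {1..n} \<times> {1..n}"
    "pair_edges 1 t \<subseteq> {1..n} \<times> {1..n}"
    using int_edges_subset[of 1 t] nc_edges_subset[of 1 t] pair_edges_subset[of 1 t] unfolding V by auto
  have fin: "finite (bonded 1 t)" using bonded_subset[of 1 t] finite_subset by blast
  have "nonx (int_edges 1 t)" "nonx (pair_edges 1 t)"
    using nonx_bonds[OF fin nonx_empty] nonx_bonds[OF fin nonx_nc_edges[of 1 t]]
    unfolding pair_edges_def ie Un_empty_right by blast+
  then have NC: "?P \<in> NC n" "?Q \<in> NC n" "?J \<in> NC n"
    using comps_in_NC[OF sub(1)] comps_in_NC[OF sub(2) nonx_nc_edges] comps_in_NC[OF sub(3)] by auto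
  have J: "comps {1..n} (same_block ?P \<union> same_block ?Q) = ?J"
    unfolding pair_edges_def
    by (intro comps_cong conn_Un_cong conn_same_block_comps sub)
  have "hasse_dist n ?P ?Q = real (card ?P) + real (card ?Q) - 2 * real (card ?J)"
    using hasse_dist_eq_join[OF NC(1,2)] NC(3) unfolding J by simp
  also have "\<dots> = of_int (weight t)"
    unfolding weight_eq[of 1 t, symmetric] V by simp
  finally show ?thesis unfolding ie .
qed

lemma sum_hasse_dist:
  "(\<Sum>P\<in>interval_partitions n. \<Sum>Q\<in>NC n. hasse_dist n P Q) = (\<Sum>t\<in>root_trees n. of_int (weight t))"
proof -
  have "(\<Sum>P\<in>interval_partitions n. \<Sum>Q\<in>NC n. hasse_dist n P Q)
      = (\<Sum>B\<in>Pow {2..n}. \<Sum>Q\<in>NC n. hasse_dist n (comps {1..n} (bonds B)) Q)"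
    by (rule sum.reindex_bij_betw[OF interval_bij, symmetric])
  also have "\<dots> = (\<Sum>(B, Q)\<in>Pow {2..n} \<times> NC n. hasse_dist n (comps {1..n} (bonds B)) Q)"
    by (rule sum.cartesian_product)
  also have "\<dots> = (\<Sum>t\<in>root_trees n. case (bonded 1 t, comps {1..n} (nc_edges 1 t)) of
      (B, Q) \<Rightarrow> hasse_dist n (comps {1..n} (bonds B)) Q)"
    by (rule sum.reindex_bij_betw[OF tree_bij, symmetric])
  also have "\<dots> = (\<Sum>t\<in>root_trees n. of_int (weight t))"
    by (intro sum.cong refl) (simp only: prod.case hasse_dist_tree)
  finally show ?thesis .
qed

section \<open>Summation over trees\<close>

definition tree_pairs :: "nat \<Rightarrow> (ct \<times> ct) set" where
  "tree_pairs n = (SIGMA l:{l. size l \<le> n}. trees (n - size l))"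

lemma tree_pairs_eq: "tree_pairs n = (\<Union>i\<le>n. trees i \<times> trees (n - i))"
  by (auto simp: tree_pairs_def trees_def)

lemma root_trees_Suc: "root_trees (Suc n) = (\<lambda>(l, r). Nd False l r) ` tree_pairs n"
proof
  show "root_trees (Suc n) \<subseteq> (\<lambda>(l, r). Nd False l r) ` tree_pairs n"
  proof
    fix t assume t: "t \<in> root_trees (Suc n)"
    then obtain l r where "t = Nd False l r" by (cases t) (auto simp: root_trees_def)
    with t show "t \<in> (\<lambda>(l, r). Nd False l r) ` tree_pairs n"
      by (intro image_eqI[of _ _ "(l, r)"]) (auto simp: root_trees_def tree_pairs_def trees_def)
  qed
qed (auto simp: root_trees_def tree_pairs_def trees_def)

lemma trees_Suc:
  "trees (Suc n) = (\<lambda>(l, r). Nd True l r) ` tree_pairs n \<union> (\<lambda>(l, r). Nd False l r) ` tree_pairs n"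
proof
  show "trees (Suc n) \<subseteq> (\<lambda>(l, r). Nd True l r) ` tree_pairs n \<union> (\<lambda>(l, r). Nd False l r) ` tree_pairs n"
  proof
    fix t assume t: "t \<in> trees (Suc n)"
    then obtain b l r where t': "t = Nd b l r" by (cases t) (auto simp: trees_def)
    with t have "(l, r) \<in> tree_pairs n" by (auto simp: tree_pairs_def trees_def)
    with t' show "t \<in> (\<lambda>(l, r). Nd True l r) ` tree_pairs n \<union> (\<lambda>(l, r). Nd False l r) ` tree_pairs n"
      by (cases b) force+
  qed
qed (auto simp: tree_pairs_def trees_def)

lemma trees_0 [simp]: "trees 0 = {Lf}"
  by (auto simp: trees_def)

lemma finite_trees [simp]: "finite (trees n)"
proof (induction n rule: less_induct)
  case (less n)
  show ?case
  proof (cases n)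
    case (Suc n')
    have "finite (tree_pairs n')"
      unfolding tree_pairs_eq using less Suc by (intro finite_UN_I finite_cartesian_product) auto
    then show ?thesis unfolding Suc trees_Suc by simp
  qed simp
qed

lemma finite_tree_pairs [simp]: "finite (tree_pairs n)"
  unfolding tree_pairs_eq by (intro finite_UN_I finite_cartesian_product) auto

section \<open>Generating functions of tree statistics\<close>

definition gf :: "(ct \<Rightarrow> real) \<Rightarrow> real fps" where
  "gf f = Abs_fps (\<lambda>n. \<Sum>t\<in>trees n. f t)"

text \<open>Pairs are graded by total size, which makes products of a factor in \<open>l\<close> and
  a factor in \<open>r\<close> correspond to products of series.\<close>

definition gf2 :: "(ct \<Rightarrow> ct \<Rightarrow> real) \<Rightarrow> real fps" where
  "gf2 F = Abs_fps (\<lambda>n. \<Sum>(l, r)\<in>tree_pairs n. F l r)"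

lemma gf_nth: "gf f $ n = (\<Sum>t\<in>trees n. f t)"
  by (simp add: gf_def)

lemma gf2_nth: "gf2 F $ n = (\<Sum>(l, r)\<in>tree_pairs n. F l r)"
  by (simp add: gf2_def)

lemma gf2_prod: "gf2 (\<lambda>l r. a l * b r) = gf a * gf b"
proof (rule fps_ext)
  fix n
  have "gf2 (\<lambda>l r. a l * b r) $ n = (\<Sum>i\<le>n. \<Sum>(l, r)\<in>trees i \<times> trees (n - i). a l * b r)"
    unfolding gf2_nth tree_pairs_eq
    by (rule sum.UNION_disjoint) (simp, simp, auto simp: trees_def)
  also have "\<dots> = (gf a * gf b) $ n"
    by (simp add: fps_mult_nth gf_nth sum_product sum.cartesian_product atLeast0AtMost)
  finally show "gf2 (\<lambda>l r. a l * b r) $ n = (gf a * gf b) $ n" .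
qed

lemma gf2_add: "gf2 (\<lambda>l r. F l r + G l r) = gf2 F + gf2 G"
  by (rule fps_ext) (simp add: gf2_nth case_prod_unfold sum.distrib)

lemma gf2_diff: "gf2 (\<lambda>l r. F l r - G l r) = gf2 F - gf2 G"
  by (rule fps_ext) (simp add: gf2_nth case_prod_unfold sum_subtractf)

lemma gf2_cmult: "gf2 (\<lambda>l r. c * F l r) = fps_const c * gf2 F"
  by (rule fps_ext) (simp add: gf2_nth case_prod_unfold sum_distrib_left)

lemma inj_Nd: "inj_on (\<lambda>(l, r). Nd b l r) A"
  by (auto simp: inj_on_def)

lemma sum_root_trees_Suc: "(\<Sum>t\<in>root_trees (Suc n). f t) = (\<Sum>(l, r)\<in>tree_pairs n. f (Nd False l r))"
  unfolding root_trees_Suc by (subst sum.reindex[OF inj_Nd]) (simp add: case_prod_unfold comp_def)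

lemma sum_trees_Suc:
  "(\<Sum>t\<in>trees (Suc n). f t) = (\<Sum>(l, r)\<in>tree_pairs n. f (Nd True l r)) + (\<Sum>(l, r)\<in>tree_pairs n. f (Nd False l r))"
proof -
  have "(\<Sum>t\<in>(\<lambda>(l, r). Nd b l r) ` tree_pairs n. f t) = (\<Sum>(l, r)\<in>tree_pairs n. f (Nd b l r))" for b
    by (subst sum.reindex[OF inj_Nd]) (simp add: case_prod_unfold comp_def)
  then show ?thesis
    unfolding trees_Suc by (subst sum.union_disjoint) auto
qed

text \<open>The factor 2 stands for the two values of the root flag, which \<open>f\<close>
  ignores.\<close>

lemma gf_Nd:
  assumes "\<And>b l r. f (Nd b l r) = F l r"
  shows "gf f = fps_const (f Lf) + 2 * fps_X * gf2 F"
proof (rule fps_ext)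
  fix n show "gf f $ n = (fps_const (f Lf) + 2 * fps_X * gf2 F) $ n"
    by (cases n) (simp_all add: gf_nth gf2_nth sum_trees_Suc assms mult.assoc numeral_fps_const)
qed

text \<open>Flipping the root flag pairs up the nonempty trees, so those with a bond at the root
  carry half of the total.\<close>

lemma gf_root_bond:
  assumes "\<And>b l r. f (Nd b l r) = F l r"
  shows "2 * gf (\<lambda>t. of_bool (root_bond t) * f t) = gf f - fps_const (f Lf)"
proof -
  have "gf (\<lambda>t. of_bool (root_bond t) * f t) = fps_X * gf2 F"
  proof (rule fps_ext)
    fix n show "gf (\<lambda>t. of_bool (root_bond t) * f t) $ n = (fps_X * gf2 F) $ n"
      by (cases n) (simp_all add: gf_nth gf2_nth sum_trees_Suc assms)
  qed
  then show ?thesis using gf_Nd[of f F, OF assms] by simp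
qed

definition gf_count :: "real fps" where "gf_count = gf (\<lambda>_. 1)"
definition gf_ends :: "real fps" where "gf_ends = gf (\<lambda>t. of_bool (ends t))"
definition gf_weight :: "real fps" where "gf_weight = gf (\<lambda>t. of_int (weight t))"

lemma gf_is_Lf: "gf (\<lambda>t. of_bool (t = Lf)) = 1"
proof (rule fps_ext)
  fix n show "gf (\<lambda>t. of_bool (t = Lf)) $ n = (1 :: real fps) $ n"
    by (cases n) (simp_all add: gf_nth sum_trees_Suc case_prod_unfold)
qed

lemma gf_diff: "gf (\<lambda>t. f t - h t) = gf f - gf h"
  by (rule fps_ext) (simp add: gf_nth sum_subtractf)

lemma tree_series: "tree_series gf_count gf_ends gf_weight"
proof
  \<comment> \<open>Indicators for an empty tree, a nonempty tree and a bond at the root. With them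
    the case distinctions in \<open>ends\<close> and \<open>weight\<close> become sums of products
    to which \<open>gf2_prod\<close> applies.\<close>
  let ?\<delta> = "\<lambda>t. of_bool (t = Lf) :: real" and ?\<nu> = "\<lambda>t. 1 - of_bool (t = Lf) :: real"
  let ?\<beta> = "\<lambda>t. of_bool (root_bond t) * 1 :: real"
  let ?e = "\<lambda>t. of_bool (ends t) :: real" and ?w = "\<lambda>t. of_int (weight t) :: real"
  let ?\<beta>e = "\<lambda>t. of_bool (root_bond t) * of_bool (ends t) :: real"
  have \<nu>: "gf ?\<nu> = gf_count - 1" by (simp add: gf_diff gf_is_Lf gf_count_def)
  have \<beta>: "2 * gf ?\<beta> = gf_count - 1"
    unfolding gf_count_def by (subst gf_root_bond[where F = "\<lambda>_ _. 1"]) auto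
  have \<beta>e: "2 * gf ?\<beta>e = gf_ends"
    unfolding gf_ends_def
    by (subst gf_root_bond[where F = "\<lambda>l r. of_bool (ends (Nd True l r))"]) auto
  show "gf_count = 1 + 2 * fps_X * gf_count\<^sup>2"
    using gf_Nd[of "\<lambda>_. 1" "\<lambda>_ _. 1 * 1"] unfolding gf2_prod by (simp add: gf_count_def power2_eq_square)
  show "gf_ends = 2 * fps_X + fps_X * gf_ends + 2 * fps_X * gf_count * gf_ends"
  proof -
    have "gf_ends = fps_const (?e Lf) + 2 * fps_X * gf2 (\<lambda>l r. 1 * ?e r + ?\<delta> l * ?\<delta> r + ?\<beta>e l * ?\<delta> r)"
      unfolding gf_ends_def by (rule gf_Nd) auto
    also have "\<dots> = 2 * fps_X * (gf_count * gf_ends + 1 + gf ?\<beta>e)"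
      unfolding gf2_add gf2_prod gf_is_Lf by (simp add: gf_count_def gf_ends_def)
    finally show ?thesis using \<beta>e by algebra
  qed
  show "gf_weight = 4 * fps_X * gf_weight * gf_count + 4 * fps_X * (gf_count - 1)\<^sup>2
      + 2 * fps_X * (gf_count - 1) - fps_X * gf_ends * (gf_count - 1)"
  proof -
    \<comment> \<open>For two nonempty subtrees the increment of \<open>weight\<close> is
      \<open>1 + ?\<beta> l + ?\<beta> r\<close>, lowered by 2 if the cycle closes. The terms with
      \<open>?\<delta>\<close> treat a single empty subtree.\<close>
    let ?F = "\<lambda>l r. ?w l * 1 + 1 * ?w r + ?\<delta> l * ?\<nu> r - ?\<delta> l * ?\<beta> r + ?\<beta> l * ?\<delta> r
      + ?\<nu> l * ?\<nu> r + ?\<beta> l * ?\<nu> r + ?\<nu> l * ?\<beta> r - 2 * (?\<beta>e l * ?\<beta> r)"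
    have "gf_weight = fps_const (?w Lf) + 2 * fps_X * gf2 ?F"
      unfolding gf_weight_def by (rule gf_Nd) auto
    also have "\<dots> = 2 * fps_X * (gf_weight * gf_count + gf_count * gf_weight + gf ?\<nu> - gf ?\<beta> + gf ?\<beta>
        + gf ?\<nu> * gf ?\<nu> + gf ?\<beta> * gf ?\<nu> + gf ?\<nu> * gf ?\<beta> - 2 * (gf ?\<beta>e * gf ?\<beta>))"
      unfolding gf2_add gf2_diff gf2_cmult[of 2] gf2_prod gf_is_Lf
      by (simp add: gf_count_def gf_weight_def numeral_fps_const)
    finally show ?thesis using \<beta> \<beta>e unfolding \<nu> by algebra
  qed
qed

interpretation tree_series gf_count gf_ends gf_weight
  by (rule tree_series)

text \<open>Both coefficients count every element of \<open>root_trees n\<close> twice, once for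
  each root flag, and the factor cancels in the quotient.\<close>

lemma mean_dist_eq:
  assumes "n > 0"
  shows "mean_dist n = (2 * real n - 4) / 3 + 2 / 3 * (gf_ends $ n / gf_count $ n)"
proof -
  obtain k where k: "n = Suc k" using assms by (cases n) auto
  have "gf_weight $ n = 2 * (\<Sum>t\<in>root_trees n. of_int (weight t))"
    unfolding gf_weight_def gf_nth k sum_trees_Suc sum_root_trees_Suc by simp
  moreover have "gf_count $ n = 2 * (2 ^ (n - 1) * catalan n)"
    unfolding g_nth k by simp
  ultimately have "mean_dist n = gf_weight $ n / gf_count $ n"
    unfolding mean_dist_def sum_hasse_dist by simp
  also have "\<dots> = (2 * real n - 4) / 3 + 2 / 3 * (gf_ends $ n / gf_count $ n)"
    using w_nth[OF assms] g_pos[of n] by (simp add: field_simps)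
  finally show ?thesis .
qed

theorem theorem1p3:
  shows "(\<lambda>n. mean_dist n - 2 / 3 * real n) \<longlonglongrightarrow> - (28 / 27)"
proof -
  have "(\<lambda>n. 2 / 3 * (gf_ends $ n / gf_count $ n) - 4 / 3) \<longlonglongrightarrow> 2 / 3 * (4 / 9) - 4 / 3"
    by (intro tendsto_intros s_over_g_tendsto)
  moreover have "\<forall>\<^sub>F n in sequentially.
      2 / 3 * (gf_ends $ n / gf_count $ n) - 4 / 3 = mean_dist n - 2 / 3 * real n"
    by (intro eventually_sequentiallyI[of 1]) (simp add: mean_dist_eq field_simps)
  ultimately show ?thesis by (simp add: tendsto_cong)
qed

end
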